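(* Let $(G,L,D)$ be a left-left nonholonomic system on a Lie group $G$. Let $\{(v_{g_k},\lambda_k)\}_{k=0}^N$, $v_{g_k}\in T_{g_k}G$, $\lambda_k\in\mathbb R^m$, be a $(p,s)$ integrator of the (unreduced) nonholonomic equations, with $p=\min(r,l)$, where $r$ is the order in the group variable and $l$ is the order in the left-trivialized velocity. Then it generates, via $\xi_k:=T_{g_k}\ell_{g_k^{-1}}v_{g_k}\in\mathfrak g$, an $(l,s)$ integrator $\{(\xi_k,\lambda_k)\}_{k=0}^N$ of the Euler-Poincaré-Suslov equations.
   Context: Left-left system: $G$ is an $n$-dimensional Lie group with Lie algebra $\mathfrak g$; $\ell_g:G\to G$, $h\mapsto gh$, is left translation. $L:TG\to\mathbb R$ is left-invariant, so $L(v_g)=l_{\rm red}(T_g\ell_{g^{-1}}v_g)$ for a reduced Lagrangian $l_{\rm red}:\mathfrak g\to\mathbb R$. $D\subset TG$ is a left-invariant constraint distribution, $D_g=T_e\ell_g\mathfrak g^D$, with $\mathfrak g^D=\{\xi\in\mathfrak g:\langle a^\alpha,\xi\rangle=0,\ \alpha=1,\dots,m\}$ for linearly independent $a^\alpha\in\mathfrak g^*$; the annihilator of $D$ is spanned by the left-invariant one-forms $\mu^\alpha(g)=\ell_{g^{-1}}^*a^\alpha$. Unreduced nonholonomic equations (in local coordinates): $\frac{d}{dt}\frac{\partial L}{\partial\dot g^i}-\frac{\partial L}{\partial g^i}=\lambda_\alpha\mu^\alpha_i(g)$, $\mu^\alpha_i(g)\dot g^i=0$; their solutions are written $(g(t),v_{g(t)},\lambda^{\rm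 unr}(t))$. Euler-Poincaré-Suslov equations: $\frac{d}{dt}\frac{\partial l_{\rm red}}{\partial\xi}=\mathrm{ad}^*_\xi\frac{\partial l_{\rm red}}{\partial\xi}+\lambda_\alpha a^\alpha$, $\langle a^\alpha,\xi\rangle=0$; their solutions are written $(\xi(t),\lambda^{\rm red}(t))$. The reduced solution corresponding to an unreduced one is $\xi(t)=T_{g(t)}\ell_{g(t)^{-1}}v_{g(t)}$. It is assumed that the equations are regular enough that the solutions, including the multipliers, are uniquely determined by their initial data. $(p,s)$ integrator of the unreduced equations ($p,s\ge0$, step size $\epsilon$, $t_{k+1}=t_k+\epsilon$): a sequence $\{(v_{g_k},\lambda_k)\}_{0:N}$, $v_{g_k}\in T_{g_k}G$, with $|g(t_k+\epsilon)-g_{k+1}|=O(\epsilon^{r+1})$, $|T_{g(t_k+\epsilon)}\ell_{g(t_k+\epsilon)^{-1}}v_{g(t_k+\epsilon)}-T_{g_{k+1}}\ell_{g_{k+1}^{-1}}v_{g_{k+1}}|=O(\epsilon^{l+1})$, $\min(r,l)=p$, and $|\lambda^{\rm unr}(t_k+\epsilon)-\lambda_{k+1}|=O(\epsilon^{s+1})$. $(p,s)$ integrator of the Euler-Poincaré-Suslov equations: a sequence $\{(\xi_k,\lambda_k)\}_{0:N}\subset\mathfrak g\times\mathbb R^m$ with $|\xi(t_k+\epsilon)-\xi_{k+1}|=O(\epsilon^{p+1})$ and $|\lambda^{\rm red}(t_k+\epsilon)-\lambda_{k+1}|=O(\epsilon^{s+1})$, $p,s\ge0$. Here $|\cdot-\cdot|$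 denotes a chosen distance on $G$ (for group elements), a fixed norm distance on $\mathfrak g$ (for algebra elements), and the Euclidean distance on $\mathbb R^m$ (for multipliers). The sequences need not satisfy the constraints. In the unreduced and reduced definitions the exact solutions compared with at each step are corresponding ones. *)

theory Defs
  imports "HOL-Analysis.Analysis" "HOL-Algebra.Group"
begin

section \<open>Smooth maps between open subsets of Euclidean spaces\<close>

text \<open>Meant for open \<open>S\<close>: the derivative is the full one at each point of \<open>S\<close>, and
  being \<open>C\<^sup>k\<^sup>+\<^sup>1\<close> means that all directional derivatives are \<open>C\<^sup>k\<close>.\<close>

primrec Ck_on :: "nat \<Rightarrow> ('a::euclidean_space \<Rightarrow> 'b::euclidean_space) \<Rightarrow> 'a set \<Rightarrow> bool" where
  "Ck_on 0 = (\<lambda>f S. continuous_on S f)"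
| "Ck_on (Suc k) = (\<lambda>f S. (\<forall>x\<in>S. f differentiable (at x)) \<and>
     (\<forall>v. Ck_on k (\<lambda>x. frechet_derivative f (at x) v) S))"

definition smooth_on :: "('a::euclidean_space \<Rightarrow> 'b::euclidean_space) \<Rightarrow> 'a set \<Rightarrow> bool" where
  "smooth_on f S \<longleftrightarrow> (\<forall>k. Ck_on k f S)"


section \<open>Lie groups\<close>

type_synonym ('g, 'n) chart = "'g set \<times> ('g \<Rightarrow> real ^ 'n)"

record ('g, 'n::finite) lie_group = "'g monoid" +
  gtop :: "'g topology"
  atlas :: "('g, 'n) chart set"

abbreviation cdom :: "('g, 'n::finite) chart \<Rightarrow> 'g set" where
  "cdom c \<equiv> fst c"

abbreviation cmap :: "('g, 'n::finite) chart \<Rightarrow> 'g \<Rightarrow> real ^ 'n" where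
  "cmap c \<equiv> snd c"

definition cinv :: "('g, 'n::finite) chart \<Rightarrow> real ^ 'n \<Rightarrow> 'g" where
  "cinv c = inv_into (cdom c) (cmap c)"

definition crange :: "('g, 'n::finite) chart \<Rightarrow> (real ^ 'n) set" where
  "crange c = cmap c ` cdom c"

definition transition :: "('g, 'n::finite) chart \<Rightarrow> ('g, 'n) chart \<Rightarrow> real ^ 'n \<Rightarrow> real ^ 'n" where
  "transition c c' = cmap c' \<circ> cinv c"

definition charts_at :: "('g, 'n::finite, 'z) lie_group_scheme \<Rightarrow> 'g \<Rightarrow> ('g, 'n) chart set" where
  "charts_at G g = {c \<in> atlas G. g \<in> cdom c}"

definition smooth_manifold :: "('g, 'n::finite, 'z) lie_group_scheme \<Rightarrow> bool" where
  "smooth_manifold G \<longleftrightarrow>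
     topspace (gtop G) = carrier G \<and> Hausdorff_space (gtop G) \<and> second_countable (gtop G) \<and>
     (\<Union>c\<in>atlas G. cdom c) = carrier G \<and>
     (\<forall>c\<in>atlas G. openin (gtop G) (cdom c) \<and> open (crange c) \<and>
        homeomorphic_map (subtopology (gtop G) (cdom c)) (top_of_set (crange c)) (cmap c)) \<and>
     (\<forall>c\<in>atlas G. \<forall>c'\<in>atlas G. smooth_on (transition c c') (cmap c ` (cdom c \<inter> cdom c')))"

definition smooth_group_operations :: "('g, 'n::finite, 'z) lie_group_scheme \<Rightarrow> bool" where
  "smooth_group_operations G \<longleftrightarrow>
     continuous_map (prod_topology (gtop G) (gtop G)) (gtop G) (\<lambda>(g, h). g \<otimes>\<^bsub>G\<^esub> h) \<and>
     (\<forall>c1\<in>atlas G. \<forall>c2\<in>atlas G. \<forall>c3\<in>atlas G.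
        smooth_on (\<lambda>(x, y). cmap c3 (cinv c1 x \<otimes>\<^bsub>G\<^esub> cinv c2 y))
          {(x, y). x \<in> crange c1 \<and> y \<in> crange c2 \<and> cinv c1 x \<otimes>\<^bsub>G\<^esub> cinv c2 y \<in> cdom c3}) \<and>
     continuous_map (gtop G) (gtop G) (\<lambda>g. inv\<^bsub>G\<^esub> g) \<and>
     (\<forall>c1\<in>atlas G. \<forall>c2\<in>atlas G.
        smooth_on (\<lambda>x. cmap c2 (inv\<^bsub>G\<^esub> (cinv c1 x)))
          {x. x \<in> crange c1 \<and> inv\<^bsub>G\<^esub> (cinv c1 x) \<in> cdom c2})"

definition is_lie_group :: "('g, 'n::finite, 'z) lie_group_scheme \<Rightarrow> bool" where
  "is_lie_group G \<longleftrightarrow> group G \<and> smooth_manifold G \<and> smooth_group_operations G"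


section \<open>Tangent vectors\<close>

text \<open>A tangent vector at \<open>g\<close> is the family of its coordinate vectors in all charts around \<open>g\<close>,
  related to each other by the Jacobians of the coordinate changes; the entries at the
  other charts are set to \<open>0\<close>, so that equality and the pointwise vector space operations
  are those of \<open>T\<^sub>gG\<close>.\<close>

type_synonym ('g, 'n) tvec = "('g, 'n) chart \<Rightarrow> real ^ 'n"

definition tangent_space :: "('g, 'n::finite, 'z) lie_group_scheme \<Rightarrow> 'g \<Rightarrow> ('g, 'n) tvec set" where
  "tangent_space G g = {v.
     (\<forall>c\<in>charts_at G g. \<forall>c'\<in>charts_at G g.
        v c' = frechet_derivative (transition c c') (at (cmap c g)) (v c)) \<and>
     (\<forall>c. c \<notin> charts_at G g \<longrightarrow> v c = 0)}"

definition tadd :: "('g, 'n::finite) tvec \<Rightarrow> ('g, 'n) tvec \<Rightarrow> ('g, 'n) tvec" where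
  "tadd v w = (\<lambda>c. v c + w c)"

definition tminus :: "('g, 'n::finite) tvec \<Rightarrow> ('g, 'n) tvec \<Rightarrow> ('g, 'n) tvec" where
  "tminus v w = (\<lambda>c. v c - w c)"

definition tscale :: "real \<Rightarrow> ('g, 'n::finite) tvec \<Rightarrow> ('g, 'n) tvec" where
  "tscale r v = (\<lambda>c. r *\<^sub>R v c)"

text \<open>The tangent vector at \<open>g\<close> with coordinates \<open>u\<close> in the chart \<open>c\<close>.\<close>

definition tvec_of :: "('g, 'n::finite, 'z) lie_group_scheme \<Rightarrow> ('g, 'n) chart \<Rightarrow> 'g \<Rightarrow> real ^ 'n
    \<Rightarrow> ('g, 'n) tvec" where
  "tvec_of G c g u = (\<lambda>c'. if c' \<in> charts_at G g
     then frechet_derivative (transition c c') (at (cmap c g)) u else 0)"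

text \<open>\<open>T\<^sub>gf\<close>, computed in an arbitrary chart around \<open>g\<close>.\<close>

definition tangent_map :: "('g, 'n::finite, 'z) lie_group_scheme \<Rightarrow> ('g \<Rightarrow> 'g) \<Rightarrow> 'g
    \<Rightarrow> ('g, 'n) tvec \<Rightarrow> ('g, 'n) tvec" where
  "tangent_map G f g v = (let c = (SOME c. c \<in> charts_at G g) in
     (\<lambda>c'. if c' \<in> charts_at G (f g)
        then frechet_derivative (cmap c' \<circ> f \<circ> cinv c) (at (cmap c g)) (v c) else 0))"

definition ltrans :: "('g, 'n::finite, 'z) lie_group_scheme \<Rightarrow> 'g \<Rightarrow> 'g \<Rightarrow> 'g" where
  "ltrans G g = (\<lambda>h. g \<otimes>\<^bsub>G\<^esub> h)"

definition left_triv :: "('g, 'n::finite, 'z) lie_group_scheme \<Rightarrow> 'g \<Rightarrow> ('g, 'n) tvec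
    \<Rightarrow> ('g, 'n) tvec" where
  "left_triv G g v = tangent_map G (ltrans G (inv\<^bsub>G\<^esub> g)) g v"


section \<open>The Lie algebra and its dual\<close>

definition lie_algebra :: "('g, 'n::finite, 'z) lie_group_scheme \<Rightarrow> ('g, 'n) tvec set" where
  "lie_algebra G = tangent_space G \<one>\<^bsub>G\<^esub>"

definition left_inv_field :: "('g, 'n::finite, 'z) lie_group_scheme \<Rightarrow> ('g, 'n) tvec
    \<Rightarrow> 'g \<Rightarrow> ('g, 'n) tvec" where
  "left_inv_field G \<xi> g = tangent_map G (ltrans G g) \<one>\<^bsub>G\<^esub> \<xi>"

text \<open>The coordinate formula \<open>[X, Y]\<^sup>i = X\<^sup>j \<partial>\<^sub>j Y\<^sup>i - Y\<^sup>j \<partial>\<^sub>j X\<^sup>i\<close>.\<close>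

definition field_bracket :: "('g, 'n::finite, 'z) lie_group_scheme \<Rightarrow> ('g \<Rightarrow> ('g, 'n) tvec)
    \<Rightarrow> ('g \<Rightarrow> ('g, 'n) tvec) \<Rightarrow> 'g \<Rightarrow> ('g, 'n) tvec" where
  "field_bracket G X Y g = (\<lambda>c. if c \<in> charts_at G g
     then frechet_derivative (\<lambda>x. Y (cinv c x) c) (at (cmap c g)) (X g c)
        - frechet_derivative (\<lambda>x. X (cinv c x) c) (at (cmap c g)) (Y g c)
     else 0)"

definition lie_bracket :: "('g, 'n::finite, 'z) lie_group_scheme \<Rightarrow> ('g, 'n) tvec
    \<Rightarrow> ('g, 'n) tvec \<Rightarrow> ('g, 'n) tvec" where
  "lie_bracket G \<xi> \<eta> = field_bracket G (left_inv_field G \<xi>) (left_inv_field G \<eta>) \<one>\<^bsub>G\<^esub>"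

text \<open>A covector is represented by the function \<open>\<xi> \<mapsto> \<langle>a, \<xi>\<rangle>\<close>; only its values on the Lie algebra
  are relevant.\<close>

definition lie_coalgebra :: "('g, 'n::finite, 'z) lie_group_scheme \<Rightarrow> (('g, 'n) tvec \<Rightarrow> real) set" where
  "lie_coalgebra G = {a. \<forall>\<xi>\<in>lie_algebra G. (\<forall>\<eta>\<in>lie_algebra G. a (tadd \<xi> \<eta>) = a \<xi> + a \<eta>) \<and>
     (\<forall>r. a (tscale r \<xi>) = r * a \<xi>)}"

definition ad_star :: "('g, 'n::finite, 'z) lie_group_scheme \<Rightarrow> ('g, 'n) tvec
    \<Rightarrow> (('g, 'n) tvec \<Rightarrow> real) \<Rightarrow> ('g, 'n) tvec \<Rightarrow> real" where
  "ad_star G \<xi> a = (\<lambda>\<eta>. a (lie_bracket G \<xi> \<eta>))"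

definition lie_algebra_norm :: "('g, 'n::finite, 'z) lie_group_scheme
    \<Rightarrow> (('g, 'n) tvec \<Rightarrow> real) \<Rightarrow> bool" where
  "lie_algebra_norm G \<nu> \<longleftrightarrow>
     (\<forall>\<xi>\<in>lie_algebra G. 0 \<le> \<nu> \<xi> \<and> (\<nu> \<xi> = 0 \<longleftrightarrow> \<xi> = (\<lambda>c. 0)) \<and>
        (\<forall>r. \<nu> (tscale r \<xi>) = \<bar>r\<bar> * \<nu> \<xi>) \<and>
        (\<forall>\<eta>\<in>lie_algebra G. \<nu> (tadd \<xi> \<eta>) \<le> \<nu> \<xi> + \<nu> \<eta>))"


section \<open>Left-left nonholonomic systems\<close>

text \<open>A Lagrangian \<open>L\<close> takes a base point \<open>g\<close> and a tangent vector at \<open>g\<close>.\<close>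

definition local_lagrangian :: "('g, 'n::finite, 'z) lie_group_scheme
    \<Rightarrow> ('g \<Rightarrow> ('g, 'n) tvec \<Rightarrow> real) \<Rightarrow> ('g, 'n) chart \<Rightarrow> (real ^ 'n) \<times> (real ^ 'n) \<Rightarrow> real" where
  "local_lagrangian G L c = (\<lambda>(x, u). L (cinv c x) (tvec_of G c (cinv c x) u))"

definition reduced_lagrangian :: "('g, 'n::finite, 'z) lie_group_scheme
    \<Rightarrow> ('g \<Rightarrow> ('g, 'n) tvec \<Rightarrow> real) \<Rightarrow> ('g, 'n) tvec \<Rightarrow> real" where
  "reduced_lagrangian G L = L \<one>\<^bsub>G\<^esub>"

definition constraint_subspace :: "('g, 'n::finite, 'z) lie_group_scheme
    \<Rightarrow> ('m::finite \<Rightarrow> ('g, 'n) tvec \<Rightarrow> real) \<Rightarrow> ('g, 'n) tvec set" where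
  "constraint_subspace G a = {\<xi> \<in> lie_algebra G. \<forall>\<alpha>. a \<alpha> \<xi> = 0}"

definition left_left_system :: "('g, 'n::finite, 'z) lie_group_scheme
    \<Rightarrow> ('g \<Rightarrow> ('g, 'n) tvec \<Rightarrow> real) \<Rightarrow> ('g \<Rightarrow> ('g, 'n) tvec set)
    \<Rightarrow> ('m::finite \<Rightarrow> ('g, 'n) tvec \<Rightarrow> real) \<Rightarrow> bool" where
  "left_left_system G L D a \<longleftrightarrow> is_lie_group G \<and>
     (\<forall>c\<in>atlas G. smooth_on (local_lagrangian G L c) (crange c \<times> UNIV)) \<and>
     (\<forall>g\<in>carrier G. \<forall>h\<in>carrier G. \<forall>v\<in>tangent_space G g.
        L (h \<otimes>\<^bsub>G\<^esub> g) (tangent_map G (ltrans G h) g v) = L g v) \<and>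
     (\<forall>\<alpha>. a \<alpha> \<in> lie_coalgebra G) \<and>
     (\<forall>b. (\<forall>\<xi>\<in>lie_algebra G. (\<Sum>\<alpha>\<in>UNIV. b \<alpha> * a \<alpha> \<xi>) = 0) \<longrightarrow> (\<forall>\<alpha>. b \<alpha> = 0)) \<and>
     (\<forall>g\<in>carrier G. D g = tangent_map G (ltrans G g) \<one>\<^bsub>G\<^esub> ` constraint_subspace G a)"


section \<open>The unreduced equations\<close>

text \<open>The component \<open>\<mu>\<^sub>i(g)\<close> in the chart \<open>c\<close> of the left-invariant one-form extending \<open>a\<close>.\<close>

definition one_form_coord :: "('g, 'n::finite, 'z) lie_group_scheme \<Rightarrow> (('g, 'n) tvec \<Rightarrow> real)
    \<Rightarrow> ('g, 'n) chart \<Rightarrow> 'g \<Rightarrow> 'n \<Rightarrow> real" where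
  "one_form_coord G a c g i = a (left_triv G g (tvec_of G c g (axis i 1)))"

definition dL_dvel :: "('g, 'n::finite, 'z) lie_group_scheme \<Rightarrow> ('g \<Rightarrow> ('g, 'n) tvec \<Rightarrow> real)
    \<Rightarrow> ('g, 'n) chart \<Rightarrow> 'n \<Rightarrow> 'g \<Rightarrow> ('g, 'n) tvec \<Rightarrow> real" where
  "dL_dvel G L c i g v =
     frechet_derivative (local_lagrangian G L c) (at (cmap c g, v c)) (0, axis i 1)"

definition dL_dpos :: "('g, 'n::finite, 'z) lie_group_scheme \<Rightarrow> ('g \<Rightarrow> ('g, 'n) tvec \<Rightarrow> real)
    \<Rightarrow> ('g, 'n) chart \<Rightarrow> 'n \<Rightarrow> 'g \<Rightarrow> ('g, 'n) tvec \<Rightarrow> real" where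
  "dL_dpos G L c i g v =
     frechet_derivative (local_lagrangian G L c) (at (cmap c g, v c)) (axis i 1, 0)"

text \<open>A solution on a time interval \<open>I\<close>: a twice differentiable curve \<open>g\<close> with velocity \<open>v\<close> and
  multipliers \<open>\<lambda>\<close>, satisfying the equations in all local coordinates.  Derivatives are taken
  within \<open>I\<close>, hence one-sided at the endpoints.\<close>

definition unreduced_solution :: "('g, 'n::finite, 'z) lie_group_scheme
    \<Rightarrow> ('g \<Rightarrow> ('g, 'n) tvec \<Rightarrow> real) \<Rightarrow> ('m::finite \<Rightarrow> ('g, 'n) tvec \<Rightarrow> real) \<Rightarrow> real set
    \<Rightarrow> (real \<Rightarrow> 'g) \<Rightarrow> (real \<Rightarrow> ('g, 'n) tvec) \<Rightarrow> (real \<Rightarrow> real ^ 'm) \<Rightarrow> bool" where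
  "unreduced_solution G L a I g v lam \<longleftrightarrow>
     continuous_map (top_of_set I) (gtop G) g \<and>
     (\<forall>t\<in>I. v t \<in> tangent_space G (g t) \<and>
        (\<forall>c\<in>charts_at G (g t).
           ((\<lambda>s. cmap c (g s)) has_vector_derivative v t c) (at t within I) \<and>
           (\<lambda>s. v s c) differentiable (at t within I) \<and>
           (\<forall>i. ((\<lambda>s. dL_dvel G L c i (g s) (v s)) has_real_derivative
                  (dL_dpos G L c i (g t) (v t)
                   + (\<Sum>\<alpha>\<in>UNIV. lam t $ \<alpha> * one_form_coord G (a \<alpha>) c (g t) i))) (at t within I)) \<and>
           (\<forall>\<alpha>. (\<Sum>i\<in>UNIV. one_form_coord G (a \<alpha>) c (g t) i * v t c $ i) = 0)))"


section \<open>The Euler-Poincare-Suslov equations\<close>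

definition dl_red :: "(('g, 'n::finite) tvec \<Rightarrow> real) \<Rightarrow> ('g, 'n) tvec \<Rightarrow> ('g, 'n) tvec \<Rightarrow> real" where
  "dl_red l \<xi> = (\<lambda>\<eta>. deriv (\<lambda>h. l (tadd \<xi> (tscale h \<eta>))) 0)"

text \<open>The equation in the (finite-dimensional) dual of the Lie algebra is evaluated on every
  element \<open>\<eta>\<close> of the Lie algebra.\<close>

definition eps_solution :: "('g, 'n::finite, 'z) lie_group_scheme
    \<Rightarrow> (('g, 'n) tvec \<Rightarrow> real) \<Rightarrow> ('m::finite \<Rightarrow> ('g, 'n) tvec \<Rightarrow> real) \<Rightarrow> real set
    \<Rightarrow> (real \<Rightarrow> ('g, 'n) tvec) \<Rightarrow> (real \<Rightarrow> real ^ 'm) \<Rightarrow> bool" where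
  "eps_solution G l a I \<xi> lam \<longleftrightarrow>
     (\<forall>t\<in>I. \<xi> t \<in> lie_algebra G \<and>
        (\<forall>c\<in>charts_at G \<one>\<^bsub>G\<^esub>. (\<lambda>s. \<xi> s c) differentiable (at t within I)) \<and>
        (\<forall>\<eta>\<in>lie_algebra G. ((\<lambda>s. dl_red l (\<xi> s) \<eta>) has_real_derivative
            (ad_star G (\<xi> t) (dl_red l (\<xi> t)) \<eta> + (\<Sum>\<alpha>\<in>UNIV. lam t $ \<alpha> * a \<alpha> \<eta>))) (at t within I)) \<and>
        (\<forall>\<alpha>. a \<alpha> (\<xi> t) = 0))"

text \<open>Solutions, including the multipliers, are determined by their initial data.\<close>

definition unreduced_unique :: "('g, 'n::finite, 'z) lie_group_scheme
    \<Rightarrow> ('g \<Rightarrow> ('g, 'n) tvec \<Rightarrow> real) \<Rightarrow> ('m::finite \<Rightarrow> ('g, 'n) tvec \<Rightarrow> real) \<Rightarrow> bool" where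
  "unreduced_unique G L a \<longleftrightarrow>
     (\<forall>t0 t1 g v lam g' v' lam'. t0 < t1 \<and>
        unreduced_solution G L a {t0..t1} g v lam \<and> unreduced_solution G L a {t0..t1} g' v' lam' \<and>
        g t0 = g' t0 \<and> v t0 = v' t0
        \<longrightarrow> (\<forall>t\<in>{t0..t1}. g t = g' t \<and> v t = v' t \<and> lam t = lam' t))"

definition eps_unique :: "('g, 'n::finite, 'z) lie_group_scheme
    \<Rightarrow> (('g, 'n) tvec \<Rightarrow> real) \<Rightarrow> ('m::finite \<Rightarrow> ('g, 'n) tvec \<Rightarrow> real) \<Rightarrow> bool" where
  "eps_unique G l a \<longleftrightarrow>
     (\<forall>t0 t1 \<xi> lam \<xi>' lam'. t0 < t1 \<and>
        eps_solution G l a {t0..t1} \<xi> lam \<and> eps_solution G l a {t0..t1} \<xi>' lam' \<and> \<xi> t0 = \<xi>' t0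
        \<longrightarrow> (\<forall>t\<in>{t0..t1}. \<xi> t = \<xi>' t \<and> lam t = lam' t))"


section \<open>Integrators\<close>

definition time_node :: "real \<Rightarrow> real \<Rightarrow> nat \<Rightarrow> real" where
  "time_node t0 \<epsilon> k = t0 + real k * \<epsilon>"

definition step_interval :: "real \<Rightarrow> real \<Rightarrow> nat \<Rightarrow> real set" where
  "step_interval t0 \<epsilon> k = {time_node t0 \<epsilon> k .. time_node t0 \<epsilon> k + \<epsilon>}"

text \<open>\<open>e \<epsilon> k = O(\<epsilon>\<^sup>q\<^sup>+\<^sup>1)\<close> as \<open>\<epsilon> \<rightarrow> 0\<close>, \<open>\<epsilon> > 0\<close>, uniformly in the steps \<open>k < N \<epsilon>\<close>.  The number of
  steps may depend on the step size; for constant \<open>N\<close> uniformity in \<open>k\<close> is automatic.\<close>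

definition local_order :: "(real \<Rightarrow> nat) \<Rightarrow> (real \<Rightarrow> nat \<Rightarrow> real) \<Rightarrow> nat \<Rightarrow> bool" where
  "local_order N e q \<longleftrightarrow>
     (\<exists>C. eventually (\<lambda>\<epsilon>. \<forall>k<N \<epsilon>. \<bar>e \<epsilon> k\<bar> \<le> C * \<epsilon> ^ (q + 1)) (at_right 0))"

text \<open>The discrete data are functions of the step size \<open>\<epsilon>\<close> and the index \<open>k\<close>.  The numerical values
  \<open>gs, vs, ls\<close> are compared with exact solutions \<open>g, v, lam\<close>, where \<open>g \<epsilon> k\<close> is the curve used on
  the step from \<open>t\<^sub>k\<close> to \<open>t\<^sub>k + \<epsilon>\<close>.  The curves for different \<open>k\<close> may, but need not, be pieces
  of one solution.\<close>

definition unreduced_integrator :: "('g, 'n::finite, 'z) lie_group_scheme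
    \<Rightarrow> ('g \<Rightarrow> ('g, 'n) tvec \<Rightarrow> real) \<Rightarrow> ('m::finite \<Rightarrow> ('g, 'n) tvec \<Rightarrow> real)
    \<Rightarrow> ('g \<Rightarrow> 'g \<Rightarrow> real) \<Rightarrow> (('g, 'n) tvec \<Rightarrow> real) \<Rightarrow> real \<Rightarrow> (real \<Rightarrow> nat)
    \<Rightarrow> (real \<Rightarrow> nat \<Rightarrow> real \<Rightarrow> 'g) \<Rightarrow> (real \<Rightarrow> nat \<Rightarrow> real \<Rightarrow> ('g, 'n) tvec)
    \<Rightarrow> (real \<Rightarrow> nat \<Rightarrow> real \<Rightarrow> real ^ 'm)
    \<Rightarrow> (real \<Rightarrow> nat \<Rightarrow> 'g) \<Rightarrow> (real \<Rightarrow> nat \<Rightarrow> ('g, 'n) tvec) \<Rightarrow> (real \<Rightarrow> nat \<Rightarrow> real ^ 'm)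
    \<Rightarrow> nat \<Rightarrow> nat \<Rightarrow> nat \<Rightarrow> nat \<Rightarrow> bool" where
  "unreduced_integrator G L a d \<nu> t0 N g v lam gs vs ls r l p s \<longleftrightarrow>
     eventually (\<lambda>\<epsilon>. \<forall>k\<le>N \<epsilon>. gs \<epsilon> k \<in> carrier G \<and> vs \<epsilon> k \<in> tangent_space G (gs \<epsilon> k)) (at_right 0) \<and>
     eventually (\<lambda>\<epsilon>. \<forall>k<N \<epsilon>.
        unreduced_solution G L a (step_interval t0 \<epsilon> k) (g \<epsilon> k) (v \<epsilon> k) (lam \<epsilon> k)) (at_right 0) \<and>
     local_order N (\<lambda>\<epsilon> k. d (g \<epsilon> k (time_node t0 \<epsilon> k + \<epsilon>)) (gs \<epsilon> (k + 1))) r \<and>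
     local_order N (\<lambda>\<epsilon> k. \<nu> (tminus
        (left_triv G (g \<epsilon> k (time_node t0 \<epsilon> k + \<epsilon>)) (v \<epsilon> k (time_node t0 \<epsilon> k + \<epsilon>)))
        (left_triv G (gs \<epsilon> (k + 1)) (vs \<epsilon> (k + 1))))) l \<and>
     min r l = p \<and>
     local_order N (\<lambda>\<epsilon> k. dist (lam \<epsilon> k (time_node t0 \<epsilon> k + \<epsilon>)) (ls \<epsilon> (k + 1))) s"

definition eps_integrator :: "('g, 'n::finite, 'z) lie_group_scheme
    \<Rightarrow> (('g, 'n) tvec \<Rightarrow> real) \<Rightarrow> ('m::finite \<Rightarrow> ('g, 'n) tvec \<Rightarrow> real)
    \<Rightarrow> (('g, 'n) tvec \<Rightarrow> real) \<Rightarrow> real \<Rightarrow> (real \<Rightarrow> nat)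
    \<Rightarrow> (real \<Rightarrow> nat \<Rightarrow> real \<Rightarrow> ('g, 'n) tvec) \<Rightarrow> (real \<Rightarrow> nat \<Rightarrow> real \<Rightarrow> real ^ 'm)
    \<Rightarrow> (real \<Rightarrow> nat \<Rightarrow> ('g, 'n) tvec) \<Rightarrow> (real \<Rightarrow> nat \<Rightarrow> real ^ 'm)
    \<Rightarrow> nat \<Rightarrow> nat \<Rightarrow> bool" where
  "eps_integrator G l a \<nu> t0 N \<xi> lam xs ls p s \<longleftrightarrow>
     eventually (\<lambda>\<epsilon>. \<forall>k\<le>N \<epsilon>. xs \<epsilon> k \<in> lie_algebra G) (at_right 0) \<and>
     eventually (\<lambda>\<epsilon>. \<forall>k<N \<epsilon>.
        eps_solution G l a (step_interval t0 \<epsilon> k) (\<xi> \<epsilon> k) (lam \<epsilon> k)) (at_right 0) \<and>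
     local_order N (\<lambda>\<epsilon> k. \<nu> (tminus (\<xi> \<epsilon> k (time_node t0 \<epsilon> k + \<epsilon>)) (xs \<epsilon> (k + 1)))) p \<and>
     local_order N (\<lambda>\<epsilon> k. dist (lam \<epsilon> k (time_node t0 \<epsilon> k + \<epsilon>)) (ls \<epsilon> (k + 1))) s"

text \<open>\<open>(\<xi>, lamr)\<close> are the reduced solutions corresponding to the curves \<open>(g, v)\<close>.  The reduced
  multipliers \<open>lamr\<close> are constrained only by the reduced equations; no relation to the
  unreduced multipliers is imposed.\<close>

definition corresponding_reduced :: "('g, 'n::finite, 'z) lie_group_scheme
    \<Rightarrow> (('g, 'n) tvec \<Rightarrow> real) \<Rightarrow> ('m::finite \<Rightarrow> ('g, 'n) tvec \<Rightarrow> real) \<Rightarrow> real \<Rightarrow> (real \<Rightarrow> nat)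
    \<Rightarrow> (real \<Rightarrow> nat \<Rightarrow> real \<Rightarrow> 'g) \<Rightarrow> (real \<Rightarrow> nat \<Rightarrow> real \<Rightarrow> ('g, 'n) tvec)
    \<Rightarrow> (real \<Rightarrow> nat \<Rightarrow> real \<Rightarrow> ('g, 'n) tvec) \<Rightarrow> (real \<Rightarrow> nat \<Rightarrow> real \<Rightarrow> real ^ 'm) \<Rightarrow> bool" where
  "corresponding_reduced G l a t0 N g v \<xi> lamr \<longleftrightarrow>
     eventually (\<lambda>\<epsilon>. \<forall>k<N \<epsilon>.
        eps_solution G l a (step_interval t0 \<epsilon> k) (\<xi> \<epsilon> k) (lamr \<epsilon> k) \<and>
        (\<forall>t\<in>step_interval t0 \<epsilon> k. \<xi> \<epsilon> k t = left_triv G (g \<epsilon> k t) (v \<epsilon> k t))) (at_right 0)"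

end

theory Submission
  imports Defs
begin

text \<open>The numerical error estimates carry over verbatim once the exact reduced solution and its
  multipliers are identified.  The substance is the Euler-Poincare-Suslov reduction: if
  \<open>(g, v, \<lambda>)\<close> solves the unreduced equations, then the left trivialization \<open>\<xi>\<close> of \<open>v\<close> solves the reduced ones with
  the same multipliers \<open>\<lambda>\<close>.  In a chart let \<open>X\<^sub>\<eta>\<close> be the left-invariant field of \<open>\<eta>\<close>.
  Left invariance gives \<open>L (x, X\<^sub>\<xi> x) = l \<xi>\<close> for all \<open>x\<close>, hence
  \<open>\<langle>\<partial>l/\<partial>\<xi>, \<eta>\<rangle> = L\<^sub>u X\<^sub>\<eta>\<close> and \<open>L\<^sub>x w = - L\<^sub>u (D X\<^sub>\<xi> w)\<close>.  Differentiating the first identity along the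
  solution and inserting the equations of motion leaves
  \<open>L\<^sub>u (D X\<^sub>\<eta> X\<^sub>\<xi> - D X\<^sub>\<xi> X\<^sub>\<eta>) + \<lambda>\<^sub>\<alpha> \<langle>a\<^sup>\<alpha>, \<eta>\<rangle>\<close>, and the bracket of left-invariant fields is the
  left-invariant field of \<open>[\<xi>, \<eta>]\<close>.  Uniqueness for the reduced equations then forces any other
  reduced multipliers to equal \<open>\<lambda>\<close>.\<close>


section \<open>Calculus\<close>

text \<open>By the mean value theorem applied to \<open>s \<mapsto> f (x + t s u + t w) - f (x + t s u)\<close>.  The limit is
  that of an expression symmetric in \<open>u\<close> and \<open>w\<close>.\<close>

lemma tendsto_second_difference:
  fixes f :: "'a::real_normed_vector \<Rightarrow> real"
  assumes S: "open S" "x \<in> S" and f: "\<And>y. y \<in> S \<Longrightarrow> f differentiable (at y)"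
    and H: "((\<lambda>y. frechet_derivative f (at y) u) has_derivative H) (at x)"
  shows "((\<lambda>t. (f (x + t *\<^sub>R u + t *\<^sub>R w) - f (x + t *\<^sub>R u) - f (x + t *\<^sub>R w) + f x) / t\<^sup>2)
    \<longlongrightarrow> H w) (at_right 0)"
proof (rule tendstoI)
  fix \<epsilon> :: real assume "\<epsilon> > 0"
  \<comment> \<open>\<open>K\<close> adds up the two displacement bounds
    \<open>norm u + norm w\<close> and \<open>norm u\<close>, per unit of \<open>t\<close>, that
    enter the error estimate; the summand 1 keeps it positive. The choice of \<open>e\<close> makes
    \<open>e * K\<close> half of \<epsilon>.\<close>
  define K where "K = 2 * norm u + norm w + 1"
  have K: "K > 0" unfolding K_def by (simp add: add_nonneg_pos)
  define e where "e = \<epsilon> / (2 * K)"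
  have e: "e > 0" using \<open>\<epsilon> > 0\<close> K by (simp add: e_def)
  from S obtain d1 where d1: "d1 > 0" "ball x d1 \<subseteq> S" by (meson openE)
  let ?D = "\<lambda>y. frechet_derivative f (at y)"
  from H e obtain d2 where d2: "d2 > 0"
    "\<And>y. norm (y - x) < d2 \<Longrightarrow> norm (?D y u - ?D x u - H (y - x)) \<le> e * norm (y - x)"
    unfolding has_derivative_at_alt by blast
  have linH: "linear H" using H by (rule has_derivative_linear)
  \<comment> \<open>For \<open>t < \<delta>\<close> all points used stay within both radii of
    \<open>x\<close>, since \<open>t * K\<close> bounds the displacements.\<close>
  define \<delta> where "\<delta> = min d1 d2 / K"
  have \<delta>: "\<delta> > 0" using d1 d2 K by (simp add: \<delta>_def)
  have main: "dist ((f (x + t *\<^sub>R u + t *\<^sub>R w) - f (x + t *\<^sub>R u) - f (x + t *\<^sub>R w) + f x) / t\<^sup>2) (H w) < \<epsilon>"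
    if t: "0 < t" "t < \<delta>" for t
  proof -
    have tK: "t * K < min d1 d2" using t K by (simp add: \<delta>_def field_simps)
    have near: "norm (t *\<^sub>R s *\<^sub>R u) \<le> t * norm u" "norm (t *\<^sub>R s *\<^sub>R u + t *\<^sub>R w) \<le> t * (norm u + norm w)"
      if "0 \<le> s" "s \<le> 1" for s
    proof -
      show 1: "norm (t *\<^sub>R s *\<^sub>R u) \<le> t * norm u"
        using that t by (simp add: mult_left_le_one_le)
      show "norm (t *\<^sub>R s *\<^sub>R u + t *\<^sub>R w) \<le> t * (norm u + norm w)"
        using norm_triangle_ineq[of "t *\<^sub>R s *\<^sub>R u" "t *\<^sub>R w"] 1 t by (simp add: algebra_simps)
    qed
    have le: "t * norm u \<le> t * K" "t * (norm u + norm w) \<le> t * K"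
      using t by (auto simp: K_def intro!: mult_left_mono add_nonneg_nonneg)
    have small: "norm (t *\<^sub>R s *\<^sub>R u) < min d1 d2" "norm (t *\<^sub>R s *\<^sub>R u + t *\<^sub>R w) < min d1 d2"
      if "0 \<le> s" "s \<le> 1" for s
      using near[OF that] le tK by linarith+
    have inS: "x + t *\<^sub>R s *\<^sub>R u \<in> S" "x + t *\<^sub>R s *\<^sub>R u + t *\<^sub>R w \<in> S" if "0 \<le> s" "s \<le> 1" for s
      using small[OF that] d1(2) by (auto simp: dist_norm norm_minus_commute subset_iff
          add.assoc simp del: scaleR_scaleR)
    define g where "g s = f (x + t *\<^sub>R s *\<^sub>R u + t *\<^sub>R w) - f (x + t *\<^sub>R s *\<^sub>R u)" for s
    define g' where "g' s = t * (?D (x + t *\<^sub>R s *\<^sub>R u + t *\<^sub>R w) u - ?D (x + t *\<^sub>R s *\<^sub>R u) u)" for s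
    have der: "((\<lambda>s. f (x + t *\<^sub>R s *\<^sub>R u + z)) has_real_derivative t * ?D (x + t *\<^sub>R s *\<^sub>R u + z) u) (at s)"
      if "x + t *\<^sub>R s *\<^sub>R u + z \<in> S" for s z
    proof -
      let ?y = "x + t *\<^sub>R s *\<^sub>R u + z"
      have fD: "(f has_derivative ?D ?y) (at ?y)"
        using f[OF that] by (simp add: frechet_derivative_works)
      have "((\<lambda>s. x + t *\<^sub>R s *\<^sub>R u + z) has_derivative (\<lambda>h. t *\<^sub>R h *\<^sub>R u)) (at s)"
        by (auto intro!: derivative_eq_intros)
      from has_derivative_compose[OF this fD]
      have "((\<lambda>s. f (x + t *\<^sub>R s *\<^sub>R u + z)) has_derivative (\<lambda>h. ?D ?y (t *\<^sub>R h *\<^sub>R u))) (at s)" .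
      moreover have "(\<lambda>h. ?D ?y (t *\<^sub>R h *\<^sub>R u)) = (*) (t * ?D ?y u)"
        using has_derivative_linear[OF fD] by (simp add: linear_scale fun_eq_iff)
      ultimately show ?thesis
        unfolding has_field_derivative_def by simp
    qed
    have gD: "(g has_real_derivative g' s) (at s)" if "0 \<le> s" "s \<le> 1" for s
      unfolding g_def g'_def right_diff_distrib
      using der[of s "t *\<^sub>R w"] der[of s 0] inS[OF that] by (intro DERIV_diff) auto
    obtain \<theta> where \<theta>: "0 < \<theta>" "\<theta> < 1" "g 1 - g 0 = (1 - 0) * g' \<theta>"
      using MVT2[of 0 1 g g'] gD by auto
    let ?k1 = "t *\<^sub>R \<theta> *\<^sub>R u + t *\<^sub>R w" and ?k2 = "t *\<^sub>R \<theta> *\<^sub>R u"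
    have b1: "\<bar>?D (x + ?k1) u - ?D x u - H ?k1\<bar> \<le> e * (t * (norm u + norm w))"
      using d2(2)[of "x + ?k1"] small[of \<theta>] near[of \<theta>] \<theta>(1,2) e
      by (auto intro: order_trans[OF _ mult_left_mono])
    have b2: "\<bar>?D (x + ?k2) u - ?D x u - H ?k2\<bar> \<le> e * (t * norm u)"
      using d2(2)[of "x + ?k2"] small[of \<theta>] near[of \<theta>] \<theta>(1,2) e
      by (auto intro: order_trans[OF _ mult_left_mono] simp del: scaleR_scaleR)
    have Hk: "H ?k1 - H ?k2 = t * H w"
      using linH by (simp add: linear_add linear_scale)
    \<comment> \<open>Both derivatives are compared with the linearization at \<open>x\<close>: the
      terms \<open>?D x u\<close> cancel, the increments differ by \<open>t *\<^sub>R w\<close>, and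
      \<open>R\<close> is what remains.\<close>
    define R where "R = ?D (x + ?k1) u - ?D (x + ?k2) u - t * H w"
    have "\<bar>R\<bar> \<le> e * (t * (norm u + norm w)) + e * (t * norm u)"
      using b1 b2 Hk unfolding R_def by linarith
    also have "\<dots> \<le> e * t * K"
      using e t by (simp add: K_def algebra_simps)
    finally have R: "\<bar>R\<bar> \<le> e * t * K" .
    have "g 1 - g 0 = t * (t * H w + R)"
      using \<theta>(3) by (simp add: g'_def R_def add.assoc)
    then have "(g 1 - g 0) / t\<^sup>2 - H w = R / t"
      using t by (simp add: field_simps power2_eq_square)
    moreover have "\<bar>R / t\<bar> \<le> e * K" using R t by (simp add: field_simps)
    moreover have "e * K < \<epsilon>" using \<open>\<epsilon> > 0\<close> K by (simp add: e_def)
    ultimately show ?thesis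
      by (simp add: g_def dist_real_def algebra_simps)
  qed
  show "\<forall>\<^sub>F t in at_right 0. dist ((f (x + t *\<^sub>R u + t *\<^sub>R w) - f (x + t *\<^sub>R u) - f (x + t *\<^sub>R w) + f x) / t\<^sup>2) (H w) < \<epsilon>"
    using main \<delta> by (auto simp: eventually_at_right_field)
qed

text \<open>Componentwise, both sides are limits of one and the same second difference, which is
  symmetric in \<open>u\<close> and \<open>w\<close>.\<close>

lemma second_derivative_symmetric:
  fixes f :: "'a::real_normed_vector \<Rightarrow> 'b::euclidean_space"
  assumes S: "open S" "x \<in> S" and f: "\<And>y. y \<in> S \<Longrightarrow> f differentiable (at y)"
    and H: "\<And>u. ((\<lambda>y. frechet_derivative f (at y) u) has_derivative H u) (at x)"
  shows "H u w = H w u"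
proof (rule euclidean_eqI)
  fix b :: 'b assume "b \<in> Basis"
  let ?f = "\<lambda>y. f y \<bullet> b"
  have fd: "(?f has_derivative (\<lambda>h. frechet_derivative f (at y) h \<bullet> b)) (at y)" if "y \<in> S" for y
    using f[OF that] unfolding frechet_derivative_works by (rule has_derivative_inner_left)
  have diff: "?f differentiable (at y)" if "y \<in> S" for y
    using fd[OF that] differentiableI by blast
  have Hb: "((\<lambda>y. frechet_derivative ?f (at y) u) has_derivative (\<lambda>h. H u h \<bullet> b)) (at x)" for u
  proof (rule has_derivative_transform_within_open[OF has_derivative_inner_left[OF H] S])
    show "frechet_derivative f (at y) u \<bullet> b = frechet_derivative ?f (at y) u" if "y \<in> S" for y
      using frechet_derivative_at[OF fd[OF that]] by metis
  qed
  from tendsto_second_difference[OF S diff Hb, where w=w and u=u]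
    tendsto_second_difference[OF S diff Hb, where w=u and u=w]
  show "H u w \<bullet> b = H w u \<bullet> b"
    by (intro tendsto_unique[OF trivial_limit_at_right_real[of 0]])
      (simp_all add: algebra_simps)
qed

text \<open>Product rule for a point-dependent linear map applied to a vector. Expanding the vector
  in \<open>Basis\<close> reduces it to finitely many products of a scalar with some
  \<open>\<Phi> x b\<close>.\<close>

lemma has_derivative_linear_family:
  fixes \<Phi> :: "'a::real_normed_vector \<Rightarrow> 'b::euclidean_space \<Rightarrow> 'c::real_normed_vector"
  assumes lin: "\<forall>\<^sub>F x in nhds x0. linear (\<Phi> x)"
    and D: "\<And>w. ((\<lambda>x. \<Phi> x w) has_derivative \<Phi>' w) (at x0)"
  shows "((\<lambda>p. \<Phi> (fst p) (snd p)) has_derivative (\<lambda>p. \<Phi>' w0 (fst p) + \<Phi> x0 (snd p))) (at (x0, w0))"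
proof -
  have expand: "\<Phi> x w = (\<Sum>b\<in>Basis. (w \<bullet> b) *\<^sub>R \<Phi> x b)" if "linear (\<Phi> x)" for x w
    using that euclidean_representation[of w] by (metis (mono_tags, lifting) linear_scale linear_sum sum.cong)
  have lin0: "linear (\<Phi> x0)" using eventually_nhds_x_imp_x[OF lin] .
  have D0: "((\<lambda>x. \<Sum>b\<in>Basis. (w \<bullet> b) *\<^sub>R \<Phi> x b) has_derivative (\<lambda>h. \<Sum>b\<in>Basis. (w \<bullet> b) *\<^sub>R \<Phi>' b h)) (at x0)" for w
    by (auto intro!: derivative_eq_intros D)
  have ev: "\<forall>\<^sub>F x in at x0. (\<Sum>b\<in>Basis. (w \<bullet> b) *\<^sub>R \<Phi> x b) = \<Phi> x w" for w
    using lin expand by (auto simp: eventually_at_filter elim: eventually_mono)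
  \<comment> \<open>The derivative inherits linearity in \<open>w\<close> from \<Phi>, because
    derivatives are unique.\<close>
  have \<Phi>': "\<Phi>' w = (\<lambda>h. \<Sum>b\<in>Basis. (w \<bullet> b) *\<^sub>R \<Phi>' b h)" for w
    using has_derivative_transform_eventually[OF D0 ev expand[OF lin0, symmetric] UNIV_I]
      D has_derivative_unique by blast
  have fst_lim: "filterlim fst (nhds x0) (nhds (x0, w0))"
    using tendsto_fst[OF filterlim_ident, of "(x0, w0)"] by simp
  have "((\<lambda>p. \<Sum>b\<in>Basis. (snd p \<bullet> b) *\<^sub>R \<Phi> (fst p) b) has_derivative
      (\<lambda>p. \<Sum>b\<in>Basis. (w0 \<bullet> b) *\<^sub>R \<Phi>' b (fst p) + (snd p \<bullet> b) *\<^sub>R \<Phi> x0 b)) (at (x0, w0))"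
  proof (intro has_derivative_sum)
    fix b :: 'b
    have 1: "((\<lambda>p. \<Phi> (fst p) b) has_derivative (\<lambda>p. \<Phi>' b (fst p))) (at (x0, w0))"
      using has_derivative_compose[of fst fst "(x0, w0)" UNIV "\<lambda>x. \<Phi> x b" "\<Phi>' b"] D[of b]
      by (simp add: has_derivative_fst)
    show "((\<lambda>p. (snd p \<bullet> b) *\<^sub>R \<Phi> (fst p) b) has_derivative
      (\<lambda>p. (w0 \<bullet> b) *\<^sub>R \<Phi>' b (fst p) + (snd p \<bullet> b) *\<^sub>R \<Phi> x0 b)) (at (x0, w0))"
      by (rule has_derivative_eq_rhs[OF has_derivative_scaleR[OF has_derivative_inner_left[OF has_derivative_snd[OF has_derivative_ident]] 1]])
        auto
  qed
  moreover have "(\<lambda>p. \<Sum>b\<in>Basis. (w0 \<bullet> b) *\<^sub>R \<Phi>' b (fst p) + (snd p \<bullet> b) *\<^sub>R \<Phi> x0 b) =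
     (\<lambda>p. \<Phi>' w0 (fst p) + \<Phi> x0 (snd p))"
  proof
    fix p :: "'a \<times> 'b"
    have "\<Phi>' w0 (fst p) = (\<Sum>b\<in>Basis. (w0 \<bullet> b) *\<^sub>R \<Phi>' b (fst p))"
      by (rule fun_cong[OF \<Phi>'])
    moreover have "\<Phi> x0 (snd p) = (\<Sum>b\<in>Basis. (snd p \<bullet> b) *\<^sub>R \<Phi> x0 b)"
      by (rule expand[OF lin0])
    ultimately show "(\<Sum>b\<in>Basis. (w0 \<bullet> b) *\<^sub>R \<Phi>' b (fst p) + (snd p \<bullet> b) *\<^sub>R \<Phi> x0 b) =
      \<Phi>' w0 (fst p) + \<Phi> x0 (snd p)"
      by (simp only: sum.distrib)
  qed
  ultimately have *: "((\<lambda>p. \<Sum>b\<in>Basis. (snd p \<bullet> b) *\<^sub>R \<Phi> (fst p) b) has_derivative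
      (\<lambda>p. \<Phi>' w0 (fst p) + \<Phi> x0 (snd p))) (at (x0, w0))"
    by simp
  have "\<forall>\<^sub>F p in nhds (x0, w0). linear (\<Phi> (fst p))"
    using lin fst_lim by (rule eventually_compose_filterlim)
  then have ev: "\<forall>\<^sub>F p in at (x0, w0). (\<Sum>b\<in>Basis. (snd p \<bullet> b) *\<^sub>R \<Phi> (fst p) b) = \<Phi> (fst p) (snd p)"
    unfolding eventually_at_filter by (rule eventually_mono) (simp add: expand[symmetric])
  show ?thesis
    by (rule has_derivative_transform_eventually[OF * ev]) (simp_all add: expand[OF lin0, symmetric])
qed

text \<open>Applied with \<open>q\<close> as base point and \<open>X\<close> as fibre coordinates,
  once for a vector field on a chart and once along a solution curve.\<close>

lemma has_derivative_linear_family_compose: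
  fixes \<Phi> :: "'a::real_normed_vector \<Rightarrow> 'b::euclidean_space \<Rightarrow> 'c::real_normed_vector"
  assumes "\<forall>\<^sub>F x in nhds (q s). linear (\<Phi> x)"
    and "\<And>w. ((\<lambda>x. \<Phi> x w) has_derivative \<Phi>' w) (at (q s))"
    and "(q has_derivative q') (at s within I)" "(X has_derivative X') (at s within I)"
  shows "((\<lambda>s. \<Phi> (q s) (X s)) has_derivative (\<lambda>h. \<Phi>' (X s) (q' h) + \<Phi> (q s) (X' h))) (at s within I)"
  using has_derivative_compose[OF has_derivative_Pair[OF assms(3,4)]
      has_derivative_linear_family[OF assms(1,2)]] by simp

lemma has_derivative_transform_nhds:
  assumes "(f has_derivative f') (at x)" "\<forall>\<^sub>F y in nhds x. f y = g y"
  shows "(g has_derivative f') (at x)"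
proof -
  have "\<forall>\<^sub>F y in at x. f y = g y"
    using assms(2) unfolding eventually_at_filter by (rule eventually_mono) simp
  then show ?thesis
    using assms(1) eventually_nhds_x_imp_x[OF assms(2)]
    by (simp add: has_derivative_transform_eventually)
qed

section \<open>Linear functionals and consequences of smoothness\<close>

lemma linear_axis_expansion:
  fixes f :: "real ^ 'n \<Rightarrow> real"
  assumes "linear f"
  shows "f w = (\<Sum>i\<in>UNIV. f (axis i 1) * w $ i)"
proof -
  have "f w = f (\<Sum>i\<in>UNIV. w $ i *\<^sub>R axis i 1)"
    using basis_expansion[of w] by (simp add: scalar_mult_eq_scaleR)
  then show ?thesis
    using assms by (simp add: linear_sum linear_scale mult.commute)
qed

lemma smooth_on_differentiable:
  assumes "smooth_on f S" "x \<in> S"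
  shows "f differentiable (at x)"
proof -
  have "Ck_on (Suc 0) f S" using assms by (simp only: smooth_on_def)
  then show ?thesis using assms(2) by simp
qed

lemma smooth_on_directional_differentiable:
  assumes "smooth_on f S" "x \<in> S"
  shows "(\<lambda>x. frechet_derivative f (at x) w) differentiable (at x)"
proof -
  have "Ck_on (Suc (Suc 0)) f S" using assms by (simp only: smooth_on_def)
  then show ?thesis using assms(2) by simp
qed


section \<open>Charts and left translations\<close>

definition ltrans_chart :: "('g, 'n::finite, 'z) lie_group_scheme \<Rightarrow> ('g, 'n) chart \<Rightarrow> 'g
    \<Rightarrow> ('g, 'n) chart \<Rightarrow> real ^ 'n \<Rightarrow> real ^ 'n" where
  "ltrans_chart G c h c' = cmap c' \<circ> ltrans G h \<circ> cinv c"

text \<open>The base point is a group element rather than a point of the chart range, so that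
  functoriality becomes multiplication of the arguments \<open>h\<close> and
  \<open>g\<close>.\<close>

definition ltrans_deriv :: "('g, 'n::finite, 'z) lie_group_scheme \<Rightarrow> ('g, 'n) chart \<Rightarrow> 'g
    \<Rightarrow> ('g, 'n) chart \<Rightarrow> 'g \<Rightarrow> real ^ 'n \<Rightarrow> real ^ 'n" where
  "ltrans_deriv G c h c' g = frechet_derivative (ltrans_chart G c h c') (at (cmap c g))"

text \<open>Charts are pairs; the simplifier must not split quantifiers over them into components.\<close>

declare split_paired_All [simp del] split_paired_Ex [simp del]

text \<open>All tangent maps in play are left translations in coordinates: coordinate changes are the case
  \<open>h = \<one>\<close>, so a single chain rule \<open>ltrans_deriv_compose\<close> covers functoriality and
  change of charts.\<close>

locale Lie_group = group G for G :: "('g, 'n::finite) lie_group" (structure) +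
  assumes lie_group: "is_lie_group G"
begin

section \<open>Charts and their inverses\<close>

lemma manifold: "smooth_manifold G"
  using lie_group unfolding is_lie_group_def by (elim conjE)

lemma chart_props:
  assumes "c \<in> atlas G"
  shows "openin (gtop G) (cdom c) \<and> open (crange c) \<and>
    homeomorphic_map (subtopology (gtop G) (cdom c)) (top_of_set (crange c)) (cmap c)"
  using manifold assms unfolding smooth_manifold_def by (elim conjE) (rule bspec)

lemmas cdom_open = chart_props[THEN conjunct1]
  and crange_open = chart_props[THEN conjunct2, THEN conjunct1]
  and chart_homeo = chart_props[THEN conjunct2, THEN conjunct2]

lemma topspace_gtop [simp]: "topspace (gtop G) = carrier G"
  using manifold unfolding smooth_manifold_def by (elim conjE)

lemma cdom_carrier: "c \<in> atlas G \<Longrightarrow> g \<in> cdom c \<Longrightarrow> g \<in> carrier G"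
  using openin_subset[OF cdom_open] by (simp add: subset_iff)

lemma charts_atD: "c \<in> charts_at G g \<Longrightarrow> c \<in> atlas G" "c \<in> charts_at G g \<Longrightarrow> g \<in> cdom c"
  "c \<in> charts_at G g \<Longrightarrow> g \<in> carrier G"
  using cdom_carrier unfolding charts_at_def by blast+

lemma ex_chart_at:
  assumes "g \<in> carrier G"
  shows "\<exists>c. c \<in> charts_at G g"
proof -
  have "(\<Union>c\<in>atlas G. cdom c) = carrier G"
    using manifold unfolding smooth_manifold_def by (elim conjE)
  then show ?thesis using assms unfolding charts_at_def by blast
qed

lemma cmap_inj:
  assumes "c \<in> atlas G"
  shows "inj_on (cmap c) (cdom c)"
proof -
  have "topspace (subtopology (gtop G) (cdom c)) = cdom c"
    using openin_subset[OF cdom_open[OF assms]] by (simp add: topspace_subtopology Int_absorb1)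
  then show ?thesis
    using homeomorphic_imp_injective_map[OF chart_homeo[OF assms]] by simp
qed

lemma cinv_cmap [simp]: "c \<in> atlas G \<Longrightarrow> g \<in> cdom c \<Longrightarrow> cinv c (cmap c g) = g"
  using cmap_inj by (simp add: cinv_def)

lemma cmap_cinv [simp]: "x \<in> crange c \<Longrightarrow> cmap c (cinv c x) = x"
  by (simp add: cinv_def crange_def f_inv_into_f)

lemma cinv_cdom [simp]: "x \<in> crange c \<Longrightarrow> cinv c x \<in> cdom c"
  by (simp add: cinv_def crange_def inv_into_into)

lemma cmap_crange [simp]: "g \<in> cdom c \<Longrightarrow> cmap c g \<in> crange c"
  by (simp add: crange_def)

lemma charts_at_cinv: "c \<in> atlas G \<Longrightarrow> x \<in> crange c \<Longrightarrow> c \<in> charts_at G (cinv c x)"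
  by (simp add: charts_at_def)

lemma cinv_carrier: "c \<in> atlas G \<Longrightarrow> x \<in> crange c \<Longrightarrow> cinv c x \<in> carrier G"
  by (rule cdom_carrier[OF _ cinv_cdom])

text \<open>A chart is a homeomorphism onto \<open>crange c\<close>, which is itself open, so
  relative openness becomes openness in \<open>real ^ 'n\<close>.\<close>

lemma open_chart_image:
  assumes c: "c \<in> atlas G" and U: "openin (gtop G) U"
  shows "open (cmap c ` (cdom c \<inter> U))"
proof -
  have "openin (subtopology (gtop G) (cdom c)) (cdom c \<inter> U)"
    using U by (metis Int_commute openin_subtopology)
  then have "openin (top_of_set (crange c)) (cmap c ` (cdom c \<inter> U))"
    using homeomorphic_imp_open_map[OF chart_homeo[OF c]] by (simp add: open_map_def)
  then show ?thesis
    using crange_open[OF c] openin_open_trans by blast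
qed

text \<open>Transfers neighbourhoods in the group to coordinates. Identities that hold only where
  all charts involved are defined can then be differentiated at a point.\<close>

lemma eventually_cinv_in:
  assumes c: "c \<in> charts_at G g" and U: "openin (gtop G) U" "g \<in> U"
  shows "\<forall>\<^sub>F x in nhds (cmap c g). x \<in> crange c \<and> cinv c x \<in> U"
proof -
  note ca = charts_atD(1)[OF c]
  have "x \<in> crange c \<and> cinv c x \<in> U" if "x \<in> cmap c ` (cdom c \<inter> U)" for x
    using that ca by auto
  moreover have "cmap c g \<in> cmap c ` (cdom c \<inter> U)"
    using charts_atD(2)[OF c] U by auto
  ultimately show ?thesis
    unfolding eventually_nhds using open_chart_image[OF ca U(1)] by blast
qed

section \<open>Multiplication and inversion in coordinates\<close>

lemma mult_cont: "continuous_map (prod_topology (gtop G) (gtop G)) (gtop G) (\<lambda>(g, h). g \<otimes> h)"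
  and inv_cont: "continuous_map (gtop G) (gtop G) (\<lambda>g. inv g)"
  by (rule lie_group[unfolded is_lie_group_def smooth_group_operations_def,
        THEN conjunct2, THEN conjunct2, THEN conjunct1],
      rule lie_group[unfolded is_lie_group_def smooth_group_operations_def,
        THEN conjunct2, THEN conjunct2, THEN conjunct2, THEN conjunct2, THEN conjunct1])

lemma ltrans_cont:
  assumes "h \<in> carrier G"
  shows "continuous_map (gtop G) (gtop G) (ltrans G h)"
proof -
  have "continuous_map (gtop G) (prod_topology (gtop G) (gtop G)) (\<lambda>g. (h, g))"
    using assms by (intro continuous_map_pairedI) auto
  from continuous_map_compose[OF this mult_cont] show ?thesis
    unfolding o_def ltrans_def prod.case .
qed

lemma eventually_mult_in:
  assumes c: "c \<in> charts_at G g" and c': "c' \<in> charts_at G h"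
    and U: "openin (gtop G) U" "g \<otimes> h \<in> U"
  shows "\<forall>\<^sub>F p in nhds (cmap c g, cmap c' h). fst p \<in> crange c \<and> snd p \<in> crange c' \<and>
    cinv c (fst p) \<otimes> cinv c' (snd p) \<in> U"
proof -
  have "openin (prod_topology (gtop G) (gtop G)) {p \<in> topspace (prod_topology (gtop G) (gtop G)). (\<lambda>(g, h). g \<otimes> h) p \<in> U}"
    by (rule openin_continuous_map_preimage[OF mult_cont U(1)])
  moreover have "(g, h) \<in> {p \<in> topspace (prod_topology (gtop G) (gtop G)). (\<lambda>(g, h). g \<otimes> h) p \<in> U}"
    using U(2) charts_atD[OF c] charts_atD[OF c'] by auto
  ultimately obtain V W where VW: "openin (gtop G) V" "openin (gtop G) W" "g \<in> V" "h \<in> W"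
    "V \<times> W \<subseteq> {p \<in> topspace (prod_topology (gtop G) (gtop G)). (\<lambda>(g, h). g \<otimes> h) p \<in> U}"
    unfolding openin_prod_topology_alt by meson
  show ?thesis
    unfolding nhds_prod eventually_prod_filter
  proof (intro exI conjI allI impI)
    show "\<forall>\<^sub>F x in nhds (cmap c g). x \<in> crange c \<and> cinv c x \<in> V"
      by (rule eventually_cinv_in[OF c VW(1,3)])
    show "\<forall>\<^sub>F x in nhds (cmap c' h). x \<in> crange c' \<and> cinv c' x \<in> W"
      by (rule eventually_cinv_in[OF c' VW(2,4)])
  qed (use VW(5) in auto)
qed

text \<open>The first fact gives the tangent maps of translations; the second lets these tangent
  maps be differentiated in turn, as the bracket requires.\<close>

lemma mult_chart_differentiable:
  assumes c: "c \<in> charts_at G g" and c': "c' \<in> charts_at G h" and c'': "c'' \<in> charts_at G (g \<otimes> h)"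
  shows "(\<lambda>(x, y). cmap c'' (cinv c x \<otimes> cinv c' y)) differentiable (at (cmap c g, cmap c' h))"
    and "(\<lambda>p. frechet_derivative (\<lambda>(x, y). cmap c'' (cinv c x \<otimes> cinv c' y)) (at p) w)
      differentiable (at (cmap c g, cmap c' h))"
proof -
  have sm: "smooth_on (\<lambda>(x, y). cmap c'' (cinv c x \<otimes> cinv c' y))
          {(x, y). x \<in> crange c \<and> y \<in> crange c' \<and> cinv c x \<otimes> cinv c' y \<in> cdom c''}"
    by (rule lie_group[unfolded is_lie_group_def smooth_group_operations_def,
        THEN conjunct2, THEN conjunct2, THEN conjunct2, THEN conjunct1, rule_format,
        OF charts_atD(1)[OF c] charts_atD(1)[OF c'] charts_atD(1)[OF c'']])
  have mem: "(cmap c g, cmap c' h) \<in> {(x, y). x \<in> crange c \<and> y \<in> crange c' \<and> cinv c x \<otimes> cinv c' y \<in> cdom c''}"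
    using charts_atD[OF c] charts_atD[OF c'] charts_atD[OF c''] by simp
  show "(\<lambda>(x, y). cmap c'' (cinv c x \<otimes> cinv c' y)) differentiable (at (cmap c g, cmap c' h))"
    by (rule smooth_on_differentiable[OF sm mem])
  show "(\<lambda>p. frechet_derivative (\<lambda>(x, y). cmap c'' (cinv c x \<otimes> cinv c' y)) (at p) w)
      differentiable (at (cmap c g, cmap c' h))"
    by (rule smooth_on_directional_differentiable[OF sm mem])
qed

lemma inv_chart_differentiable:
  assumes c: "c \<in> charts_at G g" and c': "c' \<in> charts_at G (inv g)"
  shows "(\<lambda>x. cmap c' (inv (cinv c x))) differentiable (at (cmap c g))"
proof -
  have "smooth_on (\<lambda>x. cmap c' (inv (cinv c x))) {x. x \<in> crange c \<and> inv (cinv c x) \<in> cdom c'}"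
    by (rule lie_group[unfolded is_lie_group_def smooth_group_operations_def,
        THEN conjunct2, THEN conjunct2, THEN conjunct2, THEN conjunct2, THEN conjunct2, rule_format,
        OF charts_atD(1)[OF c] charts_atD(1)[OF c']])
  then show ?thesis
    by (rule smooth_on_differentiable) (use charts_atD[OF c] charts_atD[OF c'] in auto)
qed

section \<open>Derivatives of left translations in coordinates\<close>

lemma ltrans_chart_has_derivative_mult:
  assumes ch: "ch \<in> charts_at G h" and c: "c \<in> charts_at G g" and c': "c' \<in> charts_at G (h \<otimes> g)"
  shows "(ltrans_chart G c h c' has_derivative
     (\<lambda>w. frechet_derivative (\<lambda>(x, y). cmap c' (cinv ch x \<otimes> cinv c y)) (at (cmap ch h, cmap c g)) (0, w)))
     (at (cmap c g))"
proof -
  let ?F = "\<lambda>(x, y). cmap c' (cinv ch x \<otimes> cinv c y)"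
  have F: "(?F has_derivative frechet_derivative ?F (at (cmap ch h, cmap c g))) (at (cmap ch h, cmap c g))"
    using mult_chart_differentiable(1)[OF ch c c'] by (simp add: frechet_derivative_works)
  \<comment> \<open>Freezing the first factor of the multiplication at \<open>h\<close> yields the
    translation by \<open>h\<close>.\<close>
  have "((\<lambda>y. (cmap ch h, y)) has_derivative (\<lambda>w. (0, w))) (at (cmap c g))"
    by (auto intro!: derivative_eq_intros)
  from has_derivative_compose[OF this F]
  have "((\<lambda>y. ?F (cmap ch h, y)) has_derivative
    (\<lambda>w. frechet_derivative ?F (at (cmap ch h, cmap c g)) (0, w))) (at (cmap c g))" .
  moreover have "(\<lambda>y. ?F (cmap ch h, y)) = ltrans_chart G c h c'"
    using charts_atD[OF ch] by (simp add: ltrans_chart_def ltrans_def fun_eq_iff)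
  ultimately show ?thesis by simp
qed

lemma ltrans_chart_has_derivative:
  assumes h: "h \<in> carrier G" and c: "c \<in> charts_at G g" and c': "c' \<in> charts_at G (h \<otimes> g)"
  shows "(ltrans_chart G c h c' has_derivative ltrans_deriv G c h c' g) (at (cmap c g))"
proof -
  obtain ch where "ch \<in> charts_at G h" using ex_chart_at[OF h] by blast
  from ltrans_chart_has_derivative_mult[OF this c c']
  have "ltrans_chart G c h c' differentiable (at (cmap c g))" by (rule differentiableI)
  then show ?thesis unfolding frechet_derivative_works ltrans_deriv_def .
qed

text \<open>Rewrites the derivative of a single translation as a partial derivative of the
  multiplication, whose dependence on \<open>h\<close> and \<open>g\<close> is jointly
  controlled.\<close>

lemma ltrans_deriv_mult:
  assumes ch: "ch \<in> charts_at G h" and c: "c \<in> charts_at G g" and c': "c' \<in> charts_at G (h \<otimes> g)"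
  shows "ltrans_deriv G c h c' g w =
    frechet_derivative (\<lambda>(x, y). cmap c' (cinv ch x \<otimes> cinv c y)) (at (cmap ch h, cmap c g)) (0, w)"
  by (rule fun_cong[OF has_derivative_unique[OF ltrans_chart_has_derivative[OF charts_atD(3)[OF ch] c c']
        ltrans_chart_has_derivative_mult[OF ch c c']]])

lemma linear_ltrans_deriv:
  assumes "h \<in> carrier G" "c \<in> charts_at G g" "c' \<in> charts_at G (h \<otimes> g)"
  shows "linear (ltrans_deriv G c h c' g)"
  using ltrans_chart_has_derivative[OF assms] by (rule has_derivative_linear)

lemma ltrans_chart_cmap:
  "c \<in> charts_at G g \<Longrightarrow> ltrans_chart G c h c' (cmap c g) = cmap c' (h \<otimes> g)"
  by (simp add: ltrans_chart_def ltrans_def charts_at_def)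

lemma eventually_ltrans_in:
  assumes h: "h \<in> carrier G" and c: "c \<in> charts_at G g" and U: "openin (gtop G) U" "h \<otimes> g \<in> U"
  shows "\<forall>\<^sub>F x in nhds (cmap c g). x \<in> crange c \<and> h \<otimes> cinv c x \<in> U"
proof -
  have "g \<in> {x \<in> topspace (gtop G). ltrans G h x \<in> U}"
    using U charts_atD[OF c] by (simp add: ltrans_def)
  from eventually_cinv_in[OF c openin_continuous_map_preimage[OF ltrans_cont[OF h] U(1)] this]
  show ?thesis by (rule eventually_mono) (auto simp: ltrans_def)
qed

text \<open>By associativity the two translations compose to the one by
  \<open>k \<otimes> h\<close>, but in coordinates only where the intermediate point stays in the
  domain of \<open>c'\<close>; this holds near \<open>g\<close>, which is enough for
  derivatives.\<close>

lemma ltrans_deriv_compose: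
  assumes h: "h \<in> carrier G" and k: "k \<in> carrier G" and c: "c \<in> charts_at G g"
    and c': "c' \<in> charts_at G (h \<otimes> g)" and c'': "c'' \<in> charts_at G (k \<otimes> (h \<otimes> g))"
  shows "ltrans_deriv G c' k c'' (h \<otimes> g) (ltrans_deriv G c h c' g w) = ltrans_deriv G c (k \<otimes> h) c'' g w"
proof -
  have "((\<lambda>x. ltrans_chart G c' k c'' (ltrans_chart G c h c' x)) has_derivative
      (\<lambda>w. ltrans_deriv G c' k c'' (h \<otimes> g) (ltrans_deriv G c h c' g w))) (at (cmap c g))"
    using ltrans_chart_has_derivative[OF k c' c''] ltrans_chart_cmap[OF c]
    by (intro has_derivative_compose[OF ltrans_chart_has_derivative[OF h c c']]) simp
  moreover have "\<forall>\<^sub>F x in nhds (cmap c g).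
      ltrans_chart G c' k c'' (ltrans_chart G c h c' x) = ltrans_chart G c (k \<otimes> h) c'' x"
    using eventually_ltrans_in[OF h c cdom_open[OF charts_atD(1)[OF c']] charts_atD(2)[OF c']]
  proof eventually_elim
    case (elim x)
    then show ?case
      using h k charts_atD[OF c] charts_atD[OF c'] cinv_carrier[of c x]
      by (simp add: ltrans_chart_def ltrans_def m_assoc)
  qed
  ultimately have "(ltrans_chart G c (k \<otimes> h) c'' has_derivative
      (\<lambda>w. ltrans_deriv G c' k c'' (h \<otimes> g) (ltrans_deriv G c h c' g w))) (at (cmap c g))"
    by (rule has_derivative_transform_nhds)
  moreover have "c'' \<in> charts_at G (k \<otimes> h \<otimes> g)"
    using c'' h k charts_atD[OF c] by (simp add: m_assoc)
  ultimately show ?thesis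
    using has_derivative_unique[OF _ ltrans_chart_has_derivative[OF m_closed[OF k h] c]]
    by (simp add: fun_eq_iff)
qed

lemma ltrans_deriv_one:
  assumes c: "c \<in> charts_at G g"
  shows "ltrans_deriv G c \<one> c g w = w"
proof -
  have "\<forall>\<^sub>F x in nhds (cmap c g). x = ltrans_chart G c \<one> c x"
    using eventually_cinv_in[OF c cdom_open[OF charts_atD(1)[OF c]] charts_atD(2)[OF c]]
  proof eventually_elim
    case (elim x)
    then show ?case
      using charts_atD[OF c] cinv_carrier[of c x] by (simp add: ltrans_chart_def ltrans_def)
  qed
  then have "(ltrans_chart G c \<one> c has_derivative (\<lambda>w. w)) (at (cmap c g))"
    by (rule has_derivative_transform_nhds[OF has_derivative_ident])
  moreover have "c \<in> charts_at G (\<one> \<otimes> g)"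
    using c charts_atD[OF c] by simp
  ultimately show ?thesis
    using has_derivative_unique[OF _ ltrans_chart_has_derivative[OF one_closed c]]
    by (simp add: fun_eq_iff)
qed

lemma transition_deriv:
  assumes c: "c \<in> charts_at G g" and c': "c' \<in> charts_at G g"
  shows "frechet_derivative (transition c c') (at (cmap c g)) = ltrans_deriv G c \<one> c' g"
proof -
  have "\<forall>\<^sub>F x in nhds (cmap c g). ltrans_chart G c \<one> c' x = transition c c' x"
    using eventually_cinv_in[OF c cdom_open[OF charts_atD(1)[OF c]] charts_atD(2)[OF c]]
  proof eventually_elim
    case (elim x)
    then show ?case
      using charts_atD[OF c] cinv_carrier[of c x]
      by (simp add: ltrans_chart_def ltrans_def transition_def)
  qed
  moreover have "c' \<in> charts_at G (\<one> \<otimes> g)"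
    using c' charts_atD[OF c] by simp
  ultimately have "(transition c c' has_derivative ltrans_deriv G c \<one> c' g) (at (cmap c g))"
    using has_derivative_transform_nhds[OF ltrans_chart_has_derivative[OF one_closed c]] by blast
  then show ?thesis
    using frechet_derivative_at by metis
qed

text \<open>The second order of smoothness of the multiplication enters here: near the given point
  the family agrees with a partial derivative of the multiplication in charts.\<close>

lemma ltrans_deriv_differentiable:
  assumes ch: "ch \<in> charts_at G h" and c: "c \<in> charts_at G g" and c': "c' \<in> charts_at G (h \<otimes> g)"
  shows "(\<lambda>p. ltrans_deriv G c (cinv ch (fst p)) c' (cinv c (snd p)) w)
    differentiable (at (cmap ch h, cmap c g))"
proof -
  let ?F = "\<lambda>(x, y). cmap c' (cinv ch x \<otimes> cinv c y)"
  note diff = mult_chart_differentiable(2)[OF ch c c', of "(0, w)", unfolded frechet_derivative_works]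
  have ev: "\<forall>\<^sub>F p in nhds (cmap ch h, cmap c g).
    frechet_derivative ?F (at p) (0, w) = ltrans_deriv G c (cinv ch (fst p)) c' (cinv c (snd p)) w"
    using eventually_mult_in[OF ch c cdom_open[OF charts_atD(1)[OF c']] charts_atD(2)[OF c']]
  proof eventually_elim
    case (elim p)
    then have "ch \<in> charts_at G (cinv ch (fst p))" "c \<in> charts_at G (cinv c (snd p))"
      "c' \<in> charts_at G (cinv ch (fst p) \<otimes> cinv c (snd p))"
      using charts_atD(1)[OF ch] charts_atD(1)[OF c] charts_atD(1)[OF c'] by (auto simp: charts_at_def)
    from ltrans_deriv_mult[OF this] elim show ?case by simp
  qed
  from has_derivative_transform_nhds[OF diff ev]
  show ?thesis by (rule differentiableI)
qed


section \<open>Tangent vectors\<close>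

lemma tangent_space_iff:
  "v \<in> tangent_space G g \<longleftrightarrow>
    (\<forall>c\<in>charts_at G g. \<forall>c'\<in>charts_at G g. v c' = ltrans_deriv G c \<one> c' g (v c)) \<and>
    (\<forall>c. c \<notin> charts_at G g \<longrightarrow> v c = 0)"
  by (simp add: tangent_space_def transition_deriv)

lemma tangent_spaceD:
  "v \<in> tangent_space G g \<Longrightarrow> c \<in> charts_at G g \<Longrightarrow> c' \<in> charts_at G g
    \<Longrightarrow> v c' = ltrans_deriv G c \<one> c' g (v c)"
  unfolding tangent_space_iff by blast

lemma tangent_spaceI:
  assumes "\<And>c c'. c \<in> charts_at G g \<Longrightarrow> c' \<in> charts_at G g \<Longrightarrow> v c' = ltrans_deriv G c \<one> c' g (v c)"
    and "\<And>c. c \<notin> charts_at G g \<Longrightarrow> v c = 0"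
  shows "v \<in> tangent_space G g"
  unfolding tangent_space_iff using assms by blast

text \<open>Coordinate changes determine all entries at charts around \<open>g\<close> from a single
  one, and the remaining entries are 0 on both sides.\<close>

lemma tangent_eqI:
  assumes v: "v \<in> tangent_space G g" and w: "w \<in> tangent_space G g"
    and c: "c \<in> charts_at G g" and eq: "v c = w c"
  shows "v = w"
proof
  fix c'
  show "v c' = w c'"
  proof (cases "c' \<in> charts_at G g")
    case True
    then show ?thesis using tangent_spaceD[OF v c True] tangent_spaceD[OF w c True] eq by simp
  next
    case False
    then show ?thesis using v w unfolding tangent_space_iff by simp
  qed
qed

section \<open>Tangent maps of left translations\<close>

lemma charts_at_one_mult: "c \<in> charts_at G g \<Longrightarrow> c \<in> charts_at G (\<one> \<otimes> g)"
  using charts_atD(3)[of c g] by simp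

text \<open>The definition computes in a chart picked by \<open>SOME\<close>; the chain rule with a
  coordinate change shows that every chart around \<open>g\<close> gives the same vector.\<close>

lemma tangent_map_ltrans:
  assumes h: "h \<in> carrier G" and v: "v \<in> tangent_space G g" and c: "c \<in> charts_at G g"
    and c': "c' \<in> charts_at G (h \<otimes> g)"
  shows "tangent_map G (ltrans G h) g v c' = ltrans_deriv G c h c' g (v c)"
proof -
  define c0 where "c0 = (SOME c. c \<in> charts_at G g)"
  have c0: "c0 \<in> charts_at G g" unfolding c0_def using c by (rule someI)
  have "tangent_map G (ltrans G h) g v c' = ltrans_deriv G c0 h c' g (v c0)"
    using c' by (simp add: tangent_map_def c0_def Let_def ltrans_def ltrans_deriv_def ltrans_chart_def o_def)
  also have "v c0 = ltrans_deriv G c \<one> c0 g (v c)"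
    by (rule tangent_spaceD[OF v c c0])
  also have "ltrans_deriv G c0 h c' g (ltrans_deriv G c \<one> c0 g (v c)) = ltrans_deriv G c h c' g (v c)"
    using ltrans_deriv_compose[OF one_closed h c charts_at_one_mult[OF c0], of c'] c' h charts_atD(3)[OF c]
    by simp
  finally show ?thesis .
qed

lemma tangent_map_outside: "c' \<notin> charts_at G (h \<otimes> g) \<Longrightarrow> tangent_map G (ltrans G h) g v c' = 0"
  by (simp add: tangent_map_def ltrans_def Let_def)

lemma tangent_map_in:
  assumes h: "h \<in> carrier G" and g: "g \<in> carrier G" and v: "v \<in> tangent_space G g"
  shows "tangent_map G (ltrans G h) g v \<in> tangent_space G (h \<otimes> g)"
proof -
  obtain c where c: "c \<in> charts_at G g" using ex_chart_at[OF g] by blast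
  have "tangent_map G (ltrans G h) g v c2 =
      ltrans_deriv G c1 \<one> c2 (h \<otimes> g) (tangent_map G (ltrans G h) g v c1)"
    if "c1 \<in> charts_at G (h \<otimes> g)" "c2 \<in> charts_at G (h \<otimes> g)" for c1 c2
    using ltrans_deriv_compose[OF h one_closed c that(1), of c2] that h g
    by (simp add: tangent_map_ltrans[OF h v c])
  then show ?thesis
    by (rule tangent_spaceI) (simp_all add: tangent_map_outside)
qed

lemma tangent_map_compose:
  assumes h: "h \<in> carrier G" and k: "k \<in> carrier G" and g: "g \<in> carrier G"
    and v: "v \<in> tangent_space G g"
  shows "tangent_map G (ltrans G k) (h \<otimes> g) (tangent_map G (ltrans G h) g v)
    = tangent_map G (ltrans G (k \<otimes> h)) g v"
proof -
  obtain c where c: "c \<in> charts_at G g" using ex_chart_at[OF g] by blast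
  obtain c' where c': "c' \<in> charts_at G (h \<otimes> g)" using ex_chart_at[OF m_closed[OF h g]] by blast
  obtain c'' where c'': "c'' \<in> charts_at G (k \<otimes> (h \<otimes> g))"
    using ex_chart_at[OF m_closed[OF k m_closed[OF h g]]] by blast
  have c''2: "c'' \<in> charts_at G (k \<otimes> h \<otimes> g)" using c'' h k g by (simp add: m_assoc)
  note in1 = tangent_map_in[OF h g v]
  show ?thesis
  proof (rule tangent_eqI[OF tangent_map_in[OF k m_closed[OF h g] in1] _ c''])
    show "tangent_map G (ltrans G (k \<otimes> h)) g v \<in> tangent_space G (k \<otimes> (h \<otimes> g))"
      using tangent_map_in[OF m_closed[OF k h] g v] h k g by (simp add: m_assoc)
    show "tangent_map G (ltrans G k) (h \<otimes> g) (tangent_map G (ltrans G h) g v) c''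
      = tangent_map G (ltrans G (k \<otimes> h)) g v c''"
      using tangent_map_ltrans[OF k in1 c' c''] tangent_map_ltrans[OF h v c c']
        tangent_map_ltrans[OF m_closed[OF k h] v c c''2] ltrans_deriv_compose[OF h k c c' c'']
      by simp
  qed
qed

lemma tangent_map_one:
  assumes g: "g \<in> carrier G" and v: "v \<in> tangent_space G g"
  shows "tangent_map G (ltrans G \<one>) g v = v"
proof -
  obtain c where c: "c \<in> charts_at G g" using ex_chart_at[OF g] by blast
  show ?thesis
    by (rule tangent_eqI[OF _ v c])
      (use tangent_map_in[OF one_closed g v] g tangent_map_ltrans[OF one_closed v c charts_at_one_mult[OF c]]
        ltrans_deriv_one[OF c] in simp_all)
qed

section \<open>Tangent vectors with prescribed coordinates\<close>

lemma tvec_of_chart: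
  assumes "c \<in> charts_at G g" "c' \<in> charts_at G g"
  shows "tvec_of G c g u c' = ltrans_deriv G c \<one> c' g u"
  using assms by (simp add: tvec_of_def transition_deriv)

lemma tvec_of_same: "c \<in> charts_at G g \<Longrightarrow> tvec_of G c g u c = u"
  by (simp add: tvec_of_chart ltrans_deriv_one)

lemma tvec_of_in:
  assumes c: "c \<in> charts_at G g"
  shows "tvec_of G c g u \<in> tangent_space G g"
proof -
  have "tvec_of G c g u c2 = ltrans_deriv G c1 \<one> c2 g (tvec_of G c g u c1)"
    if "c1 \<in> charts_at G g" "c2 \<in> charts_at G g" for c1 c2
    using ltrans_deriv_compose[OF one_closed one_closed c charts_at_one_mult[OF that(1)], of c2]
      that charts_atD(3)[OF c] by (simp add: tvec_of_chart[OF c])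
  then show ?thesis
    by (rule tangent_spaceI) (simp_all add: tvec_of_def)
qed

lemma tvec_of_self:
  assumes "c \<in> charts_at G g" "v \<in> tangent_space G g"
  shows "tvec_of G c g (v c) = v"
  by (rule tangent_eqI[OF tvec_of_in[OF assms(1)] assms(2,1) tvec_of_same[OF assms(1)]])

lemma linear_transition:
  "c \<in> charts_at G g \<Longrightarrow> c' \<in> charts_at G g \<Longrightarrow> linear (ltrans_deriv G c \<one> c' g)"
  by (rule linear_ltrans_deriv[OF one_closed _ charts_at_one_mult])

lemma tvec_of_add:
  assumes "c \<in> charts_at G g"
  shows "tvec_of G c g (u + w) = tadd (tvec_of G c g u) (tvec_of G c g w)"
proof
  fix c'
  show "tvec_of G c g (u + w) c' = tadd (tvec_of G c g u) (tvec_of G c g w) c'"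
    using linear_add[OF linear_transition[OF assms]] tvec_of_chart[OF assms]
    by (cases "c' \<in> charts_at G g") (simp_all add: tadd_def tvec_of_def)
qed

lemma tvec_of_scale:
  assumes "c \<in> charts_at G g"
  shows "tvec_of G c g (r *\<^sub>R u) = tscale r (tvec_of G c g u)"
proof
  fix c'
  show "tvec_of G c g (r *\<^sub>R u) c' = tscale r (tvec_of G c g u) c'"
    using linear_scale[OF linear_transition[OF assms]] tvec_of_chart[OF assms]
    by (cases "c' \<in> charts_at G g") (simp_all add: tscale_def tvec_of_def)
qed

section \<open>Left-invariant fields and left trivialization\<close>

lemma left_inv_field_in:
  "\<xi> \<in> lie_algebra G \<Longrightarrow> g \<in> carrier G \<Longrightarrow> left_inv_field G \<xi> g \<in> tangent_space G g"
  using tangent_map_in[of g \<one> \<xi>] by (simp add: left_inv_field_def lie_algebra_def)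

lemma left_inv_field_chart:
  assumes "\<xi> \<in> lie_algebra G" "e \<in> charts_at G \<one>" "c \<in> charts_at G g"
  shows "left_inv_field G \<xi> g c = ltrans_deriv G e g c \<one> (\<xi> e)"
  using tangent_map_ltrans[of g \<xi> \<one> e c] assms charts_atD(3)[OF assms(3)]
  by (simp add: left_inv_field_def lie_algebra_def)

lemma left_triv_in:
  "v \<in> tangent_space G g \<Longrightarrow> g \<in> carrier G \<Longrightarrow> left_triv G g v \<in> lie_algebra G"
  using tangent_map_in[of "inv g" g v] by (simp add: left_triv_def lie_algebra_def)

lemma left_triv_chart:
  assumes "v \<in> tangent_space G g" "e \<in> charts_at G \<one>" "c \<in> charts_at G g"
  shows "left_triv G g v e = ltrans_deriv G c (inv g) e g (v c)"
  using tangent_map_ltrans[of "inv g" v g c e] assms charts_atD(3)[OF assms(3)]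
  by (simp add: left_triv_def)

lemma left_triv_left_inv_field:
  assumes "\<xi> \<in> lie_algebra G" "g \<in> carrier G"
  shows "left_triv G g (left_inv_field G \<xi> g) = \<xi>"
  using tangent_map_compose[of g "inv g" \<one> \<xi>] tangent_map_one[of \<one> \<xi>] assms
  by (simp add: left_triv_def left_inv_field_def lie_algebra_def)

lemma left_inv_field_left_triv:
  assumes "v \<in> tangent_space G g" "g \<in> carrier G"
  shows "left_inv_field G (left_triv G g v) g = v"
  using tangent_map_compose[of "inv g" g g v] tangent_map_one[of g v] assms
  by (simp add: left_triv_def left_inv_field_def)


section \<open>The bracket of left-invariant vector fields\<close>

text \<open>Here the translating element moves while the base point stays at \<one>; this is what
  makes left-invariant fields differentiable in coordinates.\<close>

lemma left_inv_chart_differentiable: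
  assumes e: "e \<in> charts_at G \<one>" and c: "c \<in> charts_at G g"
  shows "(\<lambda>x. ltrans_deriv G e (cinv c x) c \<one> w) differentiable (at (cmap c g))"
proof -
  have "c \<in> charts_at G (g \<otimes> \<one>)" using c charts_atD(3)[OF c] by simp
  from ltrans_deriv_differentiable[OF c e this, of w, unfolded frechet_derivative_works]
  have *: "((\<lambda>p. ltrans_deriv G e (cinv c (fst p)) c (cinv e (snd p)) w) has_derivative
    frechet_derivative (\<lambda>p. ltrans_deriv G e (cinv c (fst p)) c (cinv e (snd p)) w)
      (at (cmap c g, cmap e \<one>))) (at (cmap c g, cmap e \<one>))" .
  have "((\<lambda>x. (x, cmap e \<one>)) has_derivative (\<lambda>h. (h, 0))) (at (cmap c g))"
    by (auto intro!: derivative_eq_intros)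
  from has_derivative_compose[OF this *] show ?thesis
    using charts_atD[OF e] by (auto intro: differentiableI)
qed

lemma eventually_charts_at:
  "c \<in> charts_at G g \<Longrightarrow> \<forall>\<^sub>F x in nhds (cmap c g). x \<in> crange c"
  using eventually_nhds_in_open[OF crange_open] charts_atD(1,2) by simp

lemma left_inv_field_differentiable:
  assumes \<xi>: "\<xi> \<in> lie_algebra G" and c: "c \<in> charts_at G g"
  shows "(\<lambda>x. left_inv_field G \<xi> (cinv c x) c) differentiable (at (cmap c g))"
proof -
  obtain e where e: "e \<in> charts_at G \<one>" using ex_chart_at[OF one_closed] by blast
  have "\<forall>\<^sub>F x in nhds (cmap c g).
      ltrans_deriv G e (cinv c x) c \<one> (\<xi> e) = left_inv_field G \<xi> (cinv c x) c"
    using eventually_charts_at[OF c] by (rule eventually_mono)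
      (simp add: left_inv_field_chart[OF \<xi> e] charts_at_cinv[OF charts_atD(1)[OF c]])
  from has_derivative_transform_nhds[OF left_inv_chart_differentiable[OF e c, unfolded frechet_derivative_works] this]
  show ?thesis by (rule differentiableI)
qed

text \<open>Differentiating \<open>X (g k) = T\<ell>\<^sub>g (X k)\<close> at \<open>k = \<one>\<close> produces a second
  derivative of the translation, which cancels in the bracket by symmetry.\<close>

lemma left_inv_field_bracket:
  assumes \<xi>: "\<xi> \<in> lie_algebra G" and \<eta>: "\<eta> \<in> lie_algebra G"
    and e: "e \<in> charts_at G \<one>" and c: "c \<in> charts_at G g"
  shows "field_bracket G (left_inv_field G \<xi>) (left_inv_field G \<eta>) g c
    = ltrans_deriv G e g c \<one> (lie_bracket G \<xi> \<eta> e)"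
proof -
  note g = charts_atD(3)[OF c]
  have c1: "c \<in> charts_at G (g \<otimes> \<one>)" using c g by simp
  \<comment> \<open>In coordinates, \<open>\<phi>\<close> is the translation by \<open>g\<close>
    from the chart \<open>e\<close> at the identity to the chart \<open>c\<close>,
    \<open>\<Phi> y\<close> is its derivative, and \<open>S\<close> is the open set on which the
    translated point lies in the domain of \<open>c\<close>.\<close>
  define \<phi> where "\<phi> = ltrans_chart G e g c"
  define \<Phi> where "\<Phi> y = ltrans_deriv G e g c (cinv e y)" for y
  define S where "S = cmap e ` (cdom e \<inter> {k \<in> topspace (gtop G). ltrans G g k \<in> cdom c})"
  let ?y0 = "cmap e \<one>" and ?x0 = "cmap c g"
  have S: "open S" unfolding S_def
    by (intro open_chart_image[OF charts_atD(1)[OF e]] openin_continuous_map_preimage[OF ltrans_cont[OF g]]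
        cdom_open[OF charts_atD(1)[OF c]])
  have y0: "?y0 \<in> S" unfolding S_def
    by (rule imageI) (use charts_atD[OF e] charts_atD[OF c] in \<open>simp add: ltrans_def\<close>)
  have evS: "\<forall>\<^sub>F y in nhds ?y0. y \<in> S" by (rule eventually_nhds_in_open[OF S y0])
  have SD: "y \<in> crange e" "e \<in> charts_at G (cinv e y)" "c \<in> charts_at G (g \<otimes> cinv e y)"
    "cmap e (cinv e y) = y" "cinv e y \<in> carrier G" if "y \<in> S" for y
    using that charts_atD[OF e] charts_atD[OF c] cdom_carrier
    by (auto simp: S_def charts_at_def ltrans_def)
  have \<phi>D: "(\<phi> has_derivative \<Phi> y) (at y)" if "y \<in> S" for y
    using ltrans_chart_has_derivative[OF g SD(2,3)[OF that]] SD(4)[OF that]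
    by (simp add: \<phi>_def \<Phi>_def)
  have fd\<phi>: "frechet_derivative \<phi> (at y) = \<Phi> y" if "y \<in> S" for y
    using frechet_derivative_at[OF \<phi>D[OF that]] by simp
  have \<Phi>0: "\<Phi> ?y0 = ltrans_deriv G e g c \<one>"
    using charts_atD[OF e] by (simp add: \<Phi>_def)
  have \<phi>0: "\<phi> ?y0 = ?x0"
    using ltrans_chart_cmap[OF e] g by (simp add: \<phi>_def)
  \<comment> \<open>\<open>H\<close> is the second derivative of \<open>\<phi>\<close> at the
    identity: \<open>H w\<close> differentiates the first derivative in the direction
    \<open>w\<close>.\<close>
  define H where "H w = frechet_derivative (\<lambda>y. \<Phi> y w) (at ?y0)" for w
  have HD: "((\<lambda>y. \<Phi> y w) has_derivative H w) (at ?y0)" for w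
  proof -
    note diff = ltrans_deriv_differentiable[OF c e c1, of w, unfolded frechet_derivative_works]
    have "((\<lambda>y. (cmap c g, y)) has_derivative (\<lambda>h. (0, h))) (at ?y0)"
      by (auto intro!: derivative_eq_intros)
    from has_derivative_compose[OF this diff]
    have "(\<lambda>y. ltrans_deriv G e (cinv c (cmap c g)) c (cinv e y) w) differentiable (at ?y0)"
      by (auto intro: differentiableI)
    then show ?thesis
      using charts_atD[OF c] unfolding H_def \<Phi>_def frechet_derivative_works by simp
  qed
  have sym: "H u w = H w u" for u w
  proof (rule second_derivative_symmetric[where H=H, OF S y0])
    show "\<phi> differentiable (at y)" if "y \<in> S" for y
      using \<phi>D[OF that] by (rule differentiableI)
    show "((\<lambda>y. frechet_derivative \<phi> (at y) u) has_derivative H u) (at ?y0)" for u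
      by (rule has_derivative_transform_within_open[OF HD S y0]) (simp add: fd\<phi>)
  qed
  \<comment> \<open>\<open>DX\<close> and \<open>DY\<close> differentiate the same field, at
    \<open>g\<close> in the chart \<open>c\<close> and at the identity in the chart
    \<open>e\<close>.\<close>
  define DX where "DX \<zeta> = frechet_derivative (\<lambda>x. left_inv_field G \<zeta> (cinv c x) c) (at ?x0)" for \<zeta>
  define DY where "DY \<zeta> = frechet_derivative (\<lambda>y. left_inv_field G \<zeta> (cinv e y) e) (at ?y0)" for \<zeta>
  have at_one: "left_inv_field G \<zeta> \<one> e = \<zeta> e" if "\<zeta> \<in> lie_algebra G" for \<zeta>
    using left_inv_field_chart[OF that e e] ltrans_deriv_one[OF e] by simp
  \<comment> \<open>The left side is the chain rule through \<open>\<phi>\<close>, the right side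
    the product rule for \<open>\<Phi>\<close> applied to the field; both differentiate the same
    function on \<open>S\<close>.\<close>
  have rel: "DX \<zeta> (\<Phi> ?y0 w) = H (\<zeta> e) w + \<Phi> ?y0 (DY \<zeta> w)" if \<zeta>: "\<zeta> \<in> lie_algebra G" for \<zeta> w
  proof -
    have "((\<lambda>x. left_inv_field G \<zeta> (cinv c x) c) has_derivative DX \<zeta>) (at (\<phi> ?y0))"
      using left_inv_field_differentiable[OF \<zeta> c] unfolding \<phi>0 DX_def frechet_derivative_works .
    from has_derivative_compose[OF \<phi>D[OF y0] this]
    have 1: "((\<lambda>y. left_inv_field G \<zeta> (cinv c (\<phi> y)) c) has_derivative (\<lambda>w. DX \<zeta> (\<Phi> ?y0 w))) (at ?y0)" .
    have "((\<lambda>y. left_inv_field G \<zeta> (cinv e y) e) has_derivative DY \<zeta>) (at ?y0)"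
      using left_inv_field_differentiable[OF \<zeta> e] unfolding DY_def frechet_derivative_works .
    note Y = this
    have lin: "\<forall>\<^sub>F y in nhds ?y0. linear (\<Phi> y)"
      using evS by (rule eventually_mono) (rule has_derivative_linear[OF \<phi>D])
    have 2: "((\<lambda>y. \<Phi> y (left_inv_field G \<zeta> (cinv e y) e)) has_derivative
      (\<lambda>w. H (left_inv_field G \<zeta> (cinv e ?y0) e) w + \<Phi> ?y0 (DY \<zeta> w))) (at ?y0)"
      by (rule has_derivative_linear_family_compose[where q="\<lambda>y. y" and \<Phi>=\<Phi>, OF lin HD has_derivative_ident Y])
    have "\<Phi> y (left_inv_field G \<zeta> (cinv e y) e) = left_inv_field G \<zeta> (cinv c (\<phi> y)) c" if y: "y \<in> S" for y
    proof -
      let ?k = "cinv e y"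
      note k = SD[OF y]
      have "cinv c (\<phi> y) = g \<otimes> ?k"
        using ltrans_chart_cmap[OF k(2), of g c] k(4) charts_atD[OF k(3)] by (simp add: \<phi>_def)
      moreover have "left_inv_field G \<zeta> (g \<otimes> ?k) c = ltrans_deriv G e (g \<otimes> ?k) c \<one> (\<zeta> e)"
        by (rule left_inv_field_chart[OF \<zeta> e k(3)])
      moreover have "left_inv_field G \<zeta> ?k e = ltrans_deriv G e ?k e \<one> (\<zeta> e)"
        by (rule left_inv_field_chart[OF \<zeta> e k(2)])
      moreover have "ltrans_deriv G e g c ?k (ltrans_deriv G e ?k e \<one> (\<zeta> e))
          = ltrans_deriv G e (g \<otimes> ?k) c \<one> (\<zeta> e)"
        using ltrans_deriv_compose[of ?k g e \<one> e c] k g e by simp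
      ultimately show ?thesis by (simp add: \<Phi>_def)
    qed
    from has_derivative_transform_within_open[OF 2 S y0 this]
    have "(\<lambda>w. H (left_inv_field G \<zeta> (cinv e ?y0) e) w + \<Phi> ?y0 (DY \<zeta> w)) = (\<lambda>w. DX \<zeta> (\<Phi> ?y0 w))"
      using 1 by (intro has_derivative_unique)
    then show ?thesis
      using at_one[OF \<zeta>] charts_atD[OF e] by (metis cinv_cmap)
  qed
  have X0: "left_inv_field G \<zeta> g c = \<Phi> ?y0 (\<zeta> e)" if "\<zeta> \<in> lie_algebra G" for \<zeta>
    using left_inv_field_chart[OF that e c] by (simp add: \<Phi>0)
  have "field_bracket G (left_inv_field G \<xi>) (left_inv_field G \<eta>) g c
      = DX \<eta> (\<Phi> ?y0 (\<xi> e)) - DX \<xi> (\<Phi> ?y0 (\<eta> e))"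
    using c by (simp add: field_bracket_def DX_def X0[OF \<xi>] X0[OF \<eta>])
  \<comment> \<open>The terms \<open>H (\<eta> e) (\<xi> e)\<close> and
    \<open>H (\<xi> e) (\<eta> e)\<close> cancel by symmetry.\<close>
  also have "\<dots> = \<Phi> ?y0 (DY \<eta> (\<xi> e)) - \<Phi> ?y0 (DY \<xi> (\<eta> e))"
    using rel[OF \<xi>] rel[OF \<eta>] sym[of "\<xi> e" "\<eta> e"] by simp
  also have "\<dots> = \<Phi> ?y0 (DY \<eta> (\<xi> e) - DY \<xi> (\<eta> e))"
    using has_derivative_linear[OF \<phi>D[OF y0]] by (simp add: linear_diff)
  also have "DY \<eta> (\<xi> e) - DY \<xi> (\<eta> e) = lie_bracket G \<xi> \<eta> e"
    using e by (simp add: lie_bracket_def field_bracket_def DY_def at_one[OF \<xi>] at_one[OF \<eta>])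
  finally show ?thesis by (simp add: \<Phi>0)
qed

text \<open>At \<open>g = \<one>\<close> the preceding lemma is exactly the transformation law of
  tangent vectors under coordinate changes.\<close>

lemma lie_bracket_in:
  assumes "\<xi> \<in> lie_algebra G" "\<eta> \<in> lie_algebra G"
  shows "lie_bracket G \<xi> \<eta> \<in> lie_algebra G"
  unfolding lie_algebra_def
proof (rule tangent_spaceI)
  fix c c' assume c: "c \<in> charts_at G \<one>" "c' \<in> charts_at G \<one>"
  show "lie_bracket G \<xi> \<eta> c' = ltrans_deriv G c \<one> c' \<one> (lie_bracket G \<xi> \<eta> c)"
    using left_inv_field_bracket[OF assms c] by (simp only: lie_bracket_def)
qed (simp add: lie_bracket_def field_bracket_def)


section \<open>Reduction of the equations of motion\<close>

text \<open>Covectors are linear only on the set \<open>lie_algebra G\<close>; coordinates at \<one>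
  turn them into linear functionals on all of \<open>real ^ 'n\<close>.\<close>

lemma lie_coalgebra_linear:
  assumes a: "a \<in> lie_coalgebra G" and e: "e \<in> charts_at G \<one>"
  shows "linear (\<lambda>w. a (tvec_of G e \<one> w))"
proof -
  have "tvec_of G e \<one> w \<in> lie_algebra G" for w
    using tvec_of_in[OF e] by (simp add: lie_algebra_def)
  then show ?thesis
    using a by (auto intro!: linearI simp: lie_coalgebra_def tvec_of_add[OF e] tvec_of_scale[OF e])
qed

text \<open>The left-invariant one-form at \<open>g\<close> is \<open>a\<close> composed with the
  left trivialization, hence linear in the coordinates of \<open>v\<close>. This carries both the
  constraints and the multiplier terms over to the Lie algebra.\<close>

lemma one_form_coord_sum:
  assumes a: "a \<in> lie_coalgebra G" and c: "c \<in> charts_at G g" and v: "v \<in> tangent_space G g"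
  shows "(\<Sum>i\<in>UNIV. one_form_coord G a c g i * v c $ i) = a (left_triv G g v)"
proof -
  note g = charts_atD(3)[OF c]
  obtain e where e: "e \<in> charts_at G \<one>" using ex_chart_at[OF one_closed] by blast
  define f where "f w = a (left_triv G g (tvec_of G c g w))" for w
  have lt: "left_triv G g u = tvec_of G e \<one> (ltrans_deriv G c (inv g) e g (u c))"
    if u: "u \<in> tangent_space G g" for u
    using tvec_of_self[OF e left_triv_in[OF u g, unfolded lie_algebra_def]] left_triv_chart[OF u e c]
    by simp
  have "f = (\<lambda>w. a (tvec_of G e \<one> w)) \<circ> ltrans_deriv G c (inv g) e g"
    by (simp add: f_def lt[OF tvec_of_in[OF c]] tvec_of_same[OF c] fun_eq_iff)
  moreover have "linear (ltrans_deriv G c (inv g) e g)"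
    using e g by (intro linear_ltrans_deriv c) auto
  ultimately have "linear f"
    using linear_compose[OF _ lie_coalgebra_linear[OF a e]] by simp
  from linear_axis_expansion[OF this, of "v c"] show ?thesis
    by (simp add: f_def one_form_coord_def tvec_of_self[OF c v])
qed

text \<open>The translating element \<open>inv g\<close> and the base point \<open>g\<close> move
  together, so differentiability of the inversion is combined with joint differentiability of the
  translation derivatives.\<close>

lemma left_triv_chart_differentiable:
  assumes e: "e \<in> charts_at G \<one>" and c: "c \<in> charts_at G g"
  shows "(\<lambda>x. ltrans_deriv G c (inv (cinv c x)) e (cinv c x) w) differentiable (at (cmap c g))"
proof -
  note g = charts_atD(3)[OF c]
  obtain c1 where c1: "c1 \<in> charts_at G (inv g)" using ex_chart_at[OF inv_closed[OF g]] by blast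
  have e1: "e \<in> charts_at G (inv g \<otimes> g)" using e g by simp
  let ?F = "\<lambda>p. ltrans_deriv G c (cinv c1 (fst p)) e (cinv c (snd p)) w"
  let ?J = "\<lambda>x. cmap c1 (inv (cinv c x))"
  have J0: "?J (cmap c g) = cmap c1 (inv g)" using charts_atD[OF c] by simp
  have F: "(?F has_derivative frechet_derivative ?F (at (?J (cmap c g), cmap c g)))
      (at (?J (cmap c g), cmap c g))"
    using ltrans_deriv_differentiable[OF c1 c e1, of w]
    unfolding J0 frechet_derivative_works .
  have J: "((\<lambda>x. (?J x, x)) has_derivative (\<lambda>h. (frechet_derivative ?J (at (cmap c g)) h, h))) (at (cmap c g))"
    using inv_chart_differentiable[OF c c1] unfolding frechet_derivative_works
    by (rule has_derivative_Pair) (rule has_derivative_ident)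
  have "g \<in> {x \<in> topspace (gtop G). inv x \<in> cdom c1}"
    using charts_atD[OF c1] g by simp
  from eventually_cinv_in[OF c openin_continuous_map_preimage[OF inv_cont cdom_open[OF charts_atD(1)[OF c1]]] this]
  have ev: "\<forall>\<^sub>F x in nhds (cmap c g). ?F (?J x, x) = ltrans_deriv G c (inv (cinv c x)) e (cinv c x) w"
    by (rule eventually_mono) (simp add: charts_atD(1)[OF c1])
  from has_derivative_transform_nhds[OF has_derivative_compose[OF J F] ev]
  show ?thesis by (rule differentiableI)
qed

text \<open>In coordinates the trivialization is a linear map depending on the base point, applied
  to the velocity, so the product rule along the curve applies. The result supplies the regularity
  clause of \<open>eps_solution\<close>.\<close>

lemma left_triv_curve_differentiable:
  assumes e: "e \<in> charts_at G \<one>" and c: "c \<in> charts_at G (g t)" and t: "t \<in> I"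
    and v: "\<And>s. s \<in> I \<Longrightarrow> v s \<in> tangent_space G (g s)"
    and near: "\<forall>\<^sub>F s in at t within I. s \<in> I \<and> c \<in> charts_at G (g s)"
    and gD: "(\<lambda>s. cmap c (g s)) differentiable (at t within I)"
    and vD: "(\<lambda>s. v s c) differentiable (at t within I)"
  shows "(\<lambda>s. left_triv G (g s) (v s) e) differentiable (at t within I)"
proof -
  define \<Phi> where "\<Phi> x = ltrans_deriv G c (inv (cinv c x)) e (cinv c x)" for x
  have lin: "\<forall>\<^sub>F x in nhds (cmap c (g t)). linear (\<Phi> x)"
    using eventually_charts_at[OF c]
  proof (rule eventually_mono)
    fix x assume "x \<in> crange c"
    note c' = charts_at_cinv[OF charts_atD(1)[OF c] this]
    show "linear (\<Phi> x)"
      unfolding \<Phi>_def using charts_atD(3)[OF c'] e by (intro linear_ltrans_deriv c') auto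
  qed
  have \<Phi>D: "((\<lambda>x. \<Phi> x w) has_derivative frechet_derivative (\<lambda>x. \<Phi> x w) (at (cmap c (g t)))) (at (cmap c (g t)))" for w
    using left_triv_chart_differentiable[OF e c] unfolding \<Phi>_def frechet_derivative_works .
  have val: "\<Phi> (cmap c (g s)) (v s c) = left_triv G (g s) (v s) e"
    if "s \<in> I" "c \<in> charts_at G (g s)" for s
    using left_triv_chart[OF v[OF that(1)] e that(2)] charts_atD(1,2)[OF that(2)] by (simp add: \<Phi>_def)
  obtain g' v' where "((\<lambda>s. cmap c (g s)) has_derivative g') (at t within I)"
    "((\<lambda>s. v s c) has_derivative v') (at t within I)"
    using gD vD unfolding differentiable_def by blast
  note D = has_derivative_linear_family_compose[where q="\<lambda>s. cmap c (g s)" and \<Phi>=\<Phi>, OF lin \<Phi>D this]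
  have "\<forall>\<^sub>F s in at t within I. \<Phi> (cmap c (g s)) (v s c) = left_triv G (g s) (v s) e"
    using near by (rule eventually_mono) (simp add: val)
  from has_derivative_transform_eventually[OF D this val[OF t c] t]
  show ?thesis by (rule differentiableI)
qed

text \<open>The variation of \<xi> in the definition of \<open>dl_red\<close> becomes a straight
  line in the fibre over \<open>g\<close>, because translation is linear on fibres.\<close>

lemma left_inv_field_add_scale:
  assumes \<xi>: "\<xi> \<in> lie_algebra G" and \<eta>: "\<eta> \<in> lie_algebra G" and c: "c \<in> charts_at G g"
  shows "tadd \<xi> (tscale h \<eta>) \<in> lie_algebra G"
    and "left_inv_field G (tadd \<xi> (tscale h \<eta>)) g c = left_inv_field G \<xi> g c + h *\<^sub>R left_inv_field G \<eta> g c"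
proof -
  obtain e where e: "e \<in> charts_at G \<one>" using ex_chart_at[OF one_closed] by blast
  have "tadd \<xi> (tscale h \<eta>) = tvec_of G e \<one> (\<xi> e + h *\<^sub>R \<eta> e)"
    using \<xi> \<eta> by (simp add: tvec_of_add[OF e] tvec_of_scale[OF e] tvec_of_self[OF e] lie_algebra_def)
  then show in_alg: "tadd \<xi> (tscale h \<eta>) \<in> lie_algebra G"
    using tvec_of_in[OF e] by (simp add: lie_algebra_def)
  have "linear (ltrans_deriv G e g c \<one>)"
    using c charts_atD(3)[OF c] by (intro linear_ltrans_deriv e) auto
  then show "left_inv_field G (tadd \<xi> (tscale h \<eta>)) g c = left_inv_field G \<xi> g c + h *\<^sub>R left_inv_field G \<eta> g c"
    unfolding left_inv_field_chart[OF in_alg e c] left_inv_field_chart[OF \<xi> e c] left_inv_field_chart[OF \<eta> e c]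
    by (simp add: tadd_def tscale_def linear_add linear_scale)
qed

end

section \<open>The invariant Lagrangian in coordinates\<close>

locale Left_left_system = Lie_group G for G :: "('g, 'n::finite) lie_group" (structure) +
  fixes L :: "'g \<Rightarrow> ('g, 'n) tvec \<Rightarrow> real" and D :: "'g \<Rightarrow> ('g, 'n) tvec set"
    and a :: "'m::finite \<Rightarrow> ('g, 'n) tvec \<Rightarrow> real"
  assumes system: "left_left_system G L D a"
begin

lemma lagrangian_smooth: "c \<in> atlas G \<Longrightarrow> smooth_on (local_lagrangian G L c) (crange c \<times> UNIV)"
  using system unfolding left_left_system_def by (elim conjE) (rule bspec)

lemma lagrangian_invariant:
  assumes "g \<in> carrier G" "h \<in> carrier G" "v \<in> tangent_space G g"
  shows "L (h \<otimes> g) (tangent_map G (ltrans G h) g v) = L g v"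
  using system assms unfolding left_left_system_def by (elim conjE) (drule (1) bspec)+

lemma constraint_coalgebra: "a \<alpha> \<in> lie_coalgebra G"
  using system unfolding left_left_system_def by (elim conjE) (rule spec)

lemma lagrangian_left_inv_field:
  assumes "\<xi> \<in> lie_algebra G" "g \<in> carrier G"
  shows "L g (left_inv_field G \<xi> g) = reduced_lagrangian G L \<xi>"
  using lagrangian_invariant[of \<one> g \<xi>] assms
  by (simp add: left_inv_field_def lie_algebra_def reduced_lagrangian_def)

lemma local_lagrangian_tvec:
  assumes c: "c \<in> charts_at G g" and v: "v \<in> tangent_space G g"
  shows "local_lagrangian G L c (cmap c g, v c) = L g v"
  using charts_atD[OF c] tvec_of_self[OF c v] by (simp add: local_lagrangian_def)

lemma local_lagrangian_has_derivative:
  assumes c: "c \<in> charts_at G g"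
  shows "(local_lagrangian G L c has_derivative
    frechet_derivative (local_lagrangian G L c) (at (cmap c g, u))) (at (cmap c g, u))"
proof -
  have "(cmap c g, u) \<in> crange c \<times> UNIV" using charts_atD[OF c] by simp
  from smooth_on_differentiable[OF lagrangian_smooth[OF charts_atD(1)[OF c]] this]
  show ?thesis unfolding frechet_derivative_works .
qed

text \<open>By invariance the reduced Lagrangian can be evaluated over any \<open>g\<close>, so its
  derivative is the fibre derivative of the Lagrangian there. The freedom in \<open>g\<close> allows
  following a solution curve.\<close>

lemma dl_red_chart:
  assumes \<xi>: "\<xi> \<in> lie_algebra G" and \<eta>: "\<eta> \<in> lie_algebra G" and c: "c \<in> charts_at G g"
  shows "dl_red (reduced_lagrangian G L) \<xi> \<eta> = frechet_derivative (local_lagrangian G L c)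
    (at (cmap c g, left_inv_field G \<xi> g c)) (0, left_inv_field G \<eta> g c)"
proof -
  note g = charts_atD(3)[OF c]
  let ?u = "left_inv_field G \<xi> g c" and ?w = "left_inv_field G \<eta> g c"
  let ?D = "frechet_derivative (local_lagrangian G L c) (at (cmap c g, ?u))"
  have eq: "reduced_lagrangian G L (tadd \<xi> (tscale h \<eta>)) = local_lagrangian G L c (cmap c g, ?u + h *\<^sub>R ?w)" for h
    using left_inv_field_add_scale[OF \<xi> \<eta> c, of h]
      lagrangian_left_inv_field[of "tadd \<xi> (tscale h \<eta>)" g]
      local_lagrangian_tvec[OF c left_inv_field_in[of "tadd \<xi> (tscale h \<eta>)" g]] g by simp
  have D: "(local_lagrangian G L c has_derivative ?D) (at (cmap c g, ?u + 0 *\<^sub>R ?w))"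
    using local_lagrangian_has_derivative[OF c] by simp
  have "((\<lambda>h. (cmap c g, ?u + h *\<^sub>R ?w)) has_derivative (\<lambda>h. (0, h *\<^sub>R ?w))) (at 0)"
    by (auto intro!: derivative_eq_intros)
  from has_derivative_compose[OF this D]
  have "((\<lambda>h. local_lagrangian G L c (cmap c g, ?u + h *\<^sub>R ?w)) has_derivative (\<lambda>h. ?D (0, h *\<^sub>R ?w))) (at 0)" .
  moreover have "(\<lambda>h. ?D (0, h *\<^sub>R ?w)) = (*) (?D (0, ?w))"
  proof
    fix h
    show "?D (0, h *\<^sub>R ?w) = ?D (0, ?w) * h"
      using linear_scale[OF has_derivative_linear[OF local_lagrangian_has_derivative[OF c, of ?u]], of h "(0, ?w)"]
      by simp
  qed
  ultimately have "((\<lambda>h. reduced_lagrangian G L (tadd \<xi> (tscale h \<eta>))) has_real_derivative ?D (0, ?w)) (at 0)"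
    unfolding has_field_derivative_def eq by simp
  then show ?thesis unfolding dl_red_def by (rule DERIV_imp_deriv)
qed

text \<open>The Lagrangian is constant along each left-invariant field.\<close>

lemma lagrangian_base_derivative:
  assumes \<xi>: "\<xi> \<in> lie_algebra G" and c: "c \<in> charts_at G g"
  shows "frechet_derivative (local_lagrangian G L c) (at (cmap c g, left_inv_field G \<xi> g c))
    (w, frechet_derivative (\<lambda>x. left_inv_field G \<xi> (cinv c x) c) (at (cmap c g)) w) = 0"
proof -
  let ?X = "\<lambda>x. left_inv_field G \<xi> (cinv c x) c" and ?x = "cmap c g"
  let ?D = "frechet_derivative (local_lagrangian G L c) (at (?x, left_inv_field G \<xi> g c))"
  have D: "(local_lagrangian G L c has_derivative ?D) (at (?x, ?X ?x))"
    using local_lagrangian_has_derivative[OF c] charts_atD[OF c] by simp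
  \<comment> \<open>The Lagrangian is differentiated along the graph of the field, on which it has
    the constant value given by \<open>lagrangian_left_inv_field\<close>.\<close>
  have "((\<lambda>x. (x, ?X x)) has_derivative (\<lambda>w. (w, frechet_derivative ?X (at ?x) w))) (at ?x)"
    using left_inv_field_differentiable[OF \<xi> c] unfolding frechet_derivative_works
    by (rule has_derivative_Pair[OF has_derivative_ident])
  from has_derivative_compose[OF this D]
  have 1: "((\<lambda>x. local_lagrangian G L c (x, ?X x)) has_derivative
    (\<lambda>w. ?D (w, frechet_derivative ?X (at ?x) w))) (at ?x)" .
  have "\<forall>\<^sub>F x in nhds ?x. local_lagrangian G L c (x, ?X x) = reduced_lagrangian G L \<xi>"
    using eventually_charts_at[OF c]
  proof (rule eventually_mono)
    fix x assume x: "x \<in> crange c"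
    note c' = charts_at_cinv[OF charts_atD(1)[OF c] x]
    show "local_lagrangian G L c (x, ?X x) = reduced_lagrangian G L \<xi>"
      using local_lagrangian_tvec[OF c' left_inv_field_in[OF \<xi> charts_atD(3)[OF c']]]
        lagrangian_left_inv_field[OF \<xi> charts_atD(3)[OF c']] x by simp
  qed
  from has_derivative_transform_nhds[OF 1 this]
  have "(\<lambda>w. ?D (w, frechet_derivative ?X (at ?x) w)) = (\<lambda>w. 0)"
    by (rule has_derivative_unique) (rule has_derivative_const)
  then show ?thesis by (rule fun_cong)
qed

text \<open>The total derivative is linear in each of its two slots, so the index sums in the
  equations of motion collapse to single values of it.\<close>

lemma dL_sums:
  assumes c: "c \<in> charts_at G g"
  shows "(\<Sum>i\<in>UNIV. dL_dvel G L c i g v * w $ i)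
      = frechet_derivative (local_lagrangian G L c) (at (cmap c g, v c)) (0, w)"
    and "(\<Sum>i\<in>UNIV. dL_dpos G L c i g v * w $ i)
      = frechet_derivative (local_lagrangian G L c) (at (cmap c g, v c)) (w, 0)"
proof -
  let ?D = "frechet_derivative (local_lagrangian G L c) (at (cmap c g, v c))"
  have lin: "linear ?D"
    using local_lagrangian_has_derivative[OF c] by (rule has_derivative_linear)
  have "linear (\<lambda>w. ?D (0, w))" "linear (\<lambda>w. ?D (w, 0))"
    using linear_add[OF lin, of "(0, _)" "(0, _)"] linear_add[OF lin, of "(_, 0)" "(_, 0)"]
      linear_scale[OF lin, of _ "(0, _)"] linear_scale[OF lin, of _ "(_, 0)"]
    by (auto intro!: linearI)
  from this[THEN linear_axis_expansion, of w]
  show "(\<Sum>i\<in>UNIV. dL_dvel G L c i g v * w $ i) = ?D (0, w)"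
    "(\<Sum>i\<in>UNIV. dL_dpos G L c i g v * w $ i) = ?D (w, 0)"
    by (simp_all add: dL_dvel_def dL_dpos_def)
qed

section \<open>Euler-Poincare-Suslov reduction along a solution\<close>

theorem reduced_solution:
  assumes sol: "unreduced_solution G L a I g v lam"
  shows "eps_solution G (reduced_lagrangian G L) a I (\<lambda>t. left_triv G (g t) (v t)) lam"
proof -
  let ?l = "reduced_lagrangian G L"
  define \<xi> where "\<xi> t = left_triv G (g t) (v t)" for t
  have g_cont: "continuous_map (top_of_set I) (gtop G) g"
    using sol unfolding unreduced_solution_def by (rule conjunct1)
  have v: "v t \<in> tangent_space G (g t)" if "t \<in> I" for t
    using sol that unfolding unreduced_solution_def by blast
  have g: "g t \<in> carrier G" if "t \<in> I" for t
    using continuous_map_image_subset_topspace[OF g_cont] that by auto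
  have \<xi>: "\<xi> t \<in> lie_algebra G" if "t \<in> I" for t
    unfolding \<xi>_def by (rule left_triv_in[OF v g]) (rule that)+
  have \<xi>_field: "left_inv_field G (\<xi> t) (g t) = v t" if "t \<in> I" for t
    unfolding \<xi>_def by (rule left_inv_field_left_triv[OF v g]) (rule that)+
  \<comment> \<open>A fixed chart at \<open>g t\<close> can be used only for times near
    \<open>t\<close>; continuity provides this relative to \<open>I\<close>, endpoints
    included.\<close>
  have near: "\<forall>\<^sub>F s in at t within I. s \<in> I \<and> c \<in> charts_at G (g s)"
    if t: "t \<in> I" and c: "c \<in> charts_at G (g t)" for t c
  proof -
    have "openin (top_of_set I) {s \<in> topspace (top_of_set I). g s \<in> cdom c}"
      by (rule openin_continuous_map_preimage[OF g_cont cdom_open[OF charts_atD(1)[OF c]]])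
    then obtain T where T: "open T" "{s \<in> I. g s \<in> cdom c} = I \<inter> T"
      unfolding openin_open by auto
    have "t \<in> T" using T(2) t charts_atD(2)[OF c] by blast
    then have "\<forall>\<^sub>F s in nhds t. s \<in> T" using T(1) by (simp add: eventually_nhds_in_open)
    then show ?thesis
      unfolding eventually_at_filter
      by (rule eventually_mono) (use T(2) charts_atD(1)[OF c] in \<open>auto simp: charts_at_def\<close>)
  qed
  have eqs: "((\<lambda>s. cmap c (g s)) has_vector_derivative v t c) (at t within I)"
    "(\<lambda>s. v s c) differentiable (at t within I)"
    "((\<lambda>s. dL_dvel G L c i (g s) (v s)) has_real_derivative
        (dL_dpos G L c i (g t) (v t)
           + (\<Sum>\<alpha>\<in>UNIV. lam t $ \<alpha> * one_form_coord G (a \<alpha>) c (g t) i))) (at t within I)"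
    "(\<Sum>i\<in>UNIV. one_form_coord G (a \<alpha>) c (g t) i * v t c $ i) = 0"
    if "t \<in> I" "c \<in> charts_at G (g t)" for t c i \<alpha>
    using sol that unfolding unreduced_solution_def by blast+
  have momentum: "((\<lambda>s. dl_red ?l (\<xi> s) \<eta>) has_real_derivative
      (ad_star G (\<xi> t) (dl_red ?l (\<xi> t)) \<eta> + (\<Sum>\<alpha>\<in>UNIV. lam t $ \<alpha> * a \<alpha> \<eta>))) (at t within I)"
    if t: "t \<in> I" and \<eta>: "\<eta> \<in> lie_algebra G" for t \<eta>
  proof -
    obtain c where c: "c \<in> charts_at G (g t)" using ex_chart_at[OF g[OF t]] by blast
    \<comment> \<open>In the chart \<open>c\<close>, \<open>X \<zeta>\<close> is the left-invariant
      field of \<zeta> along the curve and \<open>DX \<zeta>\<close> its spatial derivative at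
      \<open>g t\<close>; \<open>p\<close> is the total derivative of the Lagrangian, with position
      and velocity slots.\<close>
    define X where "X \<zeta> s = left_inv_field G \<zeta> (g s) c" for \<zeta> s
    define DX where "DX \<zeta> = frechet_derivative (\<lambda>x. left_inv_field G \<zeta> (cinv c x) c) (at (cmap c (g t)))" for \<zeta>
    define p where "p = frechet_derivative (local_lagrangian G L c) (at (cmap c (g t), v t c))"
    have lin_p: "linear p"
      unfolding p_def using local_lagrangian_has_derivative[OF c] by (rule has_derivative_linear)
    have \<xi>c: "X (\<xi> t) t = v t c" by (simp add: X_def \<xi>_field[OF t])
    have XD: "((\<lambda>s. X \<eta> s $ i) has_real_derivative DX \<eta> (v t c) $ i) (at t within I)" for i
    proof -
      have 1: "((\<lambda>x. left_inv_field G \<eta> (cinv c x) c) has_derivative DX \<eta>) (at (cmap c (g t)))"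
        using left_inv_field_differentiable[OF \<eta> c] unfolding DX_def frechet_derivative_works .
      have val: "left_inv_field G \<eta> (cinv c (cmap c (g s))) c = X \<eta> s" if "c \<in> charts_at G (g s)" for s
        using charts_atD[OF that] by (simp add: X_def)
      have ev: "\<forall>\<^sub>F s in at t within I. left_inv_field G \<eta> (cinv c (cmap c (g s))) c = X \<eta> s"
        using near[OF t c] by (rule eventually_mono) (simp add: val)
      have "(X \<eta> has_derivative (\<lambda>h. DX \<eta> (h *\<^sub>R v t c))) (at t within I)"
        by (rule has_derivative_transform_eventually[OF has_derivative_compose[OF
                eqs(1)[OF t c, unfolded has_vector_derivative_def] 1] ev val[OF c] t])
      then have "(X \<eta> has_vector_derivative DX \<eta> (v t c)) (at t within I)"
        unfolding has_vector_derivative_def using linear_scale[OF has_derivative_linear[OF 1]] by simp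
      from bounded_linear.has_vector_derivative[OF bounded_linear_vec_nth this, of i]
      show ?thesis by (simp add: has_real_derivative_iff_has_vector_derivative)
    qed
    have val: "(\<Sum>i\<in>UNIV. dL_dvel G L c i (g s) (v s) * X \<eta> s $ i) = dl_red ?l (\<xi> s) \<eta>"
      if s: "s \<in> I" "c \<in> charts_at G (g s)" for s
      using dL_sums(1)[OF s(2)] dl_red_chart[OF \<xi>[OF s(1)] \<eta> s(2)]
      by (simp add: X_def \<xi>_field[OF s(1)])
    have ev: "\<forall>\<^sub>F s in at t within I. (\<Sum>i\<in>UNIV. dL_dvel G L c i (g s) (v s) * X \<eta> s $ i) = dl_red ?l (\<xi> s) \<eta>"
      using near[OF t c] by (rule eventually_mono) (simp add: val)
    \<comment> \<open>By the equations of motion \<open>d i\<close> is the time derivative of the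
      momentum component \<open>i\<close>; \<open>R\<close> is the product-rule derivative of the
      momentum paired with the field of \<eta>.\<close>
    define d where "d i = (dL_dpos G L c i (g t) (v t)
           + (\<Sum>\<alpha>\<in>UNIV. lam t $ \<alpha> * one_form_coord G (a \<alpha>) c (g t) i))" for i
    define R where "R = (\<Sum>i\<in>UNIV. dL_dvel G L c i (g t) (v t) * DX \<eta> (v t c) $ i + d i * X \<eta> t $ i)"
    have "((\<lambda>s. \<Sum>i\<in>UNIV. dL_dvel G L c i (g s) (v s) * X \<eta> s $ i) has_real_derivative R) (at t within I)"
      unfolding R_def d_def by (intro DERIV_sum DERIV_mult'[OF eqs(3)[OF t c] XD])
    then have deriv: "((\<lambda>s. dl_red ?l (\<xi> s) \<eta>) has_real_derivative R) (at t within I)"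
      unfolding has_field_derivative_def
      by (rule has_derivative_transform_eventually[OF _ ev val[OF t c] t])
    have "R = p (0, DX \<eta> (v t c)) + p (X \<eta> t, 0)
        + (\<Sum>i\<in>UNIV. \<Sum>\<alpha>\<in>UNIV. lam t $ \<alpha> * one_form_coord G (a \<alpha>) c (g t) i * X \<eta> t $ i)"
      by (simp add: R_def d_def p_def sum.distrib distrib_right sum_distrib_right add.assoc
          flip: dL_sums[OF c])
    also have "(\<Sum>i\<in>UNIV. \<Sum>\<alpha>\<in>UNIV. lam t $ \<alpha> * one_form_coord G (a \<alpha>) c (g t) i * X \<eta> t $ i)
        = (\<Sum>\<alpha>\<in>UNIV. lam t $ \<alpha> * (\<Sum>i\<in>UNIV. one_form_coord G (a \<alpha>) c (g t) i * X \<eta> t $ i))"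
      by (subst sum.swap) (simp add: sum_distrib_left mult.assoc)
    also have "\<dots> = (\<Sum>\<alpha>\<in>UNIV. lam t $ \<alpha> * a \<alpha> \<eta>)"
      unfolding X_def one_form_coord_sum[OF constraint_coalgebra c left_inv_field_in[OF \<eta> g[OF t]]]
        left_triv_left_inv_field[OF \<eta> g[OF t]] ..
    \<comment> \<open>With \<xi> frozen at time \<open>t\<close>, its field passes through
      \<open>v t\<close> at \<open>g t\<close>. Constancy of the Lagrangian along this field trades
      the position derivative for a velocity derivative.\<close>
    also have "p (X \<eta> t, 0) = - p (0, DX (\<xi> t) (X \<eta> t))"
      using lagrangian_base_derivative[OF \<xi>[OF t] c, of "X \<eta> t"]
        linear_add[OF lin_p, of "(X \<eta> t, 0)" "(0, DX (\<xi> t) (X \<eta> t))"]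
      by (simp add: p_def DX_def \<xi>_field[OF t])
    also have "p (0, DX \<eta> (v t c)) + - p (0, DX (\<xi> t) (X \<eta> t))
        = p (0, DX \<eta> (v t c) - DX (\<xi> t) (X \<eta> t))"
      using linear_diff[OF lin_p, of "(0, DX \<eta> (v t c))" "(0, DX (\<xi> t) (X \<eta> t))"] by simp
    \<comment> \<open>As \<open>v t\<close> is the value of the field of \<open>\<xi> t\<close>,
      this is the coordinate bracket with \<open>\<xi> t\<close> in first place, the order that
      \<open>ad_star\<close> uses.\<close>
    also have "DX \<eta> (v t c) - DX (\<xi> t) (X \<eta> t)
        = field_bracket G (left_inv_field G (\<xi> t)) (left_inv_field G \<eta>) (g t) c"
      using c by (simp add: field_bracket_def DX_def X_def \<xi>_field[OF t])
    also have "\<dots> = left_inv_field G (lie_bracket G (\<xi> t) \<eta>) (g t) c"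
    proof -
      obtain e where e: "e \<in> charts_at G \<one>" using ex_chart_at[OF one_closed] by blast
      show ?thesis
        using left_inv_field_bracket[OF \<xi>[OF t] \<eta> e c]
          left_inv_field_chart[OF lie_bracket_in[OF \<xi>[OF t] \<eta>] e c] by simp
    qed
    also have "p (0, left_inv_field G (lie_bracket G (\<xi> t) \<eta>) (g t) c) = ad_star G (\<xi> t) (dl_red ?l (\<xi> t)) \<eta>"
      using dl_red_chart[OF \<xi>[OF t] lie_bracket_in[OF \<xi>[OF t] \<eta>] c]
      by (simp add: ad_star_def p_def \<xi>_field[OF t])
    finally show ?thesis using deriv by simp
  qed
  have smooth: "(\<lambda>s. \<xi> s e) differentiable (at t within I)" if t: "t \<in> I" and e: "e \<in> charts_at G \<one>" for t e
  proof -
    obtain c where c: "c \<in> charts_at G (g t)" using ex_chart_at[OF g[OF t]] by blast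
    have "(\<lambda>s. cmap c (g s)) differentiable (at t within I)"
      using eqs(1)[OF t c] unfolding has_vector_derivative_def by (rule differentiableI)
    from left_triv_curve_differentiable[OF e c t v near[OF t c] this eqs(2)[OF t c]]
    show ?thesis by (simp add: \<xi>_def)
  qed
  have constr: "a \<alpha> (\<xi> t) = 0" if t: "t \<in> I" for t \<alpha>
  proof -
    obtain c where c: "c \<in> charts_at G (g t)" using ex_chart_at[OF g[OF t]] by blast
    show ?thesis
      using one_form_coord_sum[OF constraint_coalgebra c v[OF t]] eqs(4)[OF t c] by (simp add: \<xi>_def)
  qed
  show ?thesis
    unfolding eps_solution_def \<xi>_def[symmetric] using \<xi> smooth momentum constr by blast
qed

end

section \<open>Transfer of the error orders to the reduced integrator\<close>

theorem proposition4p1: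
  fixes G :: "('g, 'n::finite) lie_group"
    and L :: "'g \<Rightarrow> ('g, 'n) tvec \<Rightarrow> real"
    and D :: "'g \<Rightarrow> ('g, 'n) tvec set"
    and a :: "'m::finite \<Rightarrow> ('g, 'n) tvec \<Rightarrow> real"
    and d :: "'g \<Rightarrow> 'g \<Rightarrow> real"
    and \<nu> :: "('g, 'n) tvec \<Rightarrow> real"
    and t0 :: real and N :: "real \<Rightarrow> nat"
    and g :: "real \<Rightarrow> nat \<Rightarrow> real \<Rightarrow> 'g"
    and v :: "real \<Rightarrow> nat \<Rightarrow> real \<Rightarrow> ('g, 'n) tvec"
    and lam :: "real \<Rightarrow> nat \<Rightarrow> real \<Rightarrow> real ^ 'm"
    and gs :: "real \<Rightarrow> nat \<Rightarrow> 'g"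
    and vs :: "real \<Rightarrow> nat \<Rightarrow> ('g, 'n) tvec"
    and ls :: "real \<Rightarrow> nat \<Rightarrow> real ^ 'm"
    and r l p s :: nat
  assumes "left_left_system G L D a"
    and "unreduced_unique G L a"
    and "eps_unique G (reduced_lagrangian G L) a"
    and "Metric_space (carrier G) d"
    and "lie_algebra_norm G \<nu>"
    and "unreduced_integrator G L a d \<nu> t0 N g v lam gs vs ls r l p s"
  shows "(\<exists>\<xi> lamr. corresponding_reduced G (reduced_lagrangian G L) a t0 N g v \<xi> lamr) \<and>
    (\<forall>\<xi> lamr. corresponding_reduced G (reduced_lagrangian G L) a t0 N g v \<xi> lamr \<longrightarrow>
       eps_integrator G (reduced_lagrangian G L) a \<nu> t0 N \<xi> lamr
         (\<lambda>\<epsilon> k. left_triv G (gs \<epsilon> k) (vs \<epsilon> k)) ls l s)"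
proof -
  have lie: "is_lie_group G"
    using assms(1) unfolding left_left_system_def by (rule conjunct1)
  interpret Left_left_system G L D a
    using lie assms(1)
    by (simp add: Left_left_system_def Left_left_system_axioms_def Lie_group_def Lie_group_axioms_def
        is_lie_group_def)
  let ?l = "reduced_lagrangian G L"
  let ?\<xi> = "\<lambda>\<epsilon> k t. left_triv G (g \<epsilon> k t) (v \<epsilon> k t)"
  have nodes: "\<forall>\<^sub>F \<epsilon> in at_right 0. \<forall>k\<le>N \<epsilon>. gs \<epsilon> k \<in> carrier G \<and> vs \<epsilon> k \<in> tangent_space G (gs \<epsilon> k)"
    and sol: "\<forall>\<^sub>F \<epsilon> in at_right 0. \<forall>k<N \<epsilon>.
        unreduced_solution G L a (step_interval t0 \<epsilon> k) (g \<epsilon> k) (v \<epsilon> k) (lam \<epsilon> k)"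
    and vel: "local_order N (\<lambda>\<epsilon> k. \<nu> (tminus (?\<xi> \<epsilon> k (time_node t0 \<epsilon> k + \<epsilon>))
        (left_triv G (gs \<epsilon> (k + 1)) (vs \<epsilon> (k + 1))))) l"
    and mult: "local_order N (\<lambda>\<epsilon> k. dist (lam \<epsilon> k (time_node t0 \<epsilon> k + \<epsilon>)) (ls \<epsilon> (k + 1))) s"
    using assms(6) unfolding unreduced_integrator_def by simp_all
  have pos: "\<forall>\<^sub>F \<epsilon> in at_right 0. (0::real) < \<epsilon>"
    by (rule eventually_at_right_less)
  have red: "\<forall>\<^sub>F \<epsilon> in at_right 0. \<forall>k<N \<epsilon>.
      eps_solution G ?l a (step_interval t0 \<epsilon> k) (?\<xi> \<epsilon> k) (lam \<epsilon> k)"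
    using sol by (rule eventually_mono) (blast intro: reduced_solution)
  \<comment> \<open>Orders depend only on the errors at small positive step sizes, so they may be
    compared after eventual agreement.\<close>
  have order_cong: "local_order N e' q"
    if "local_order N e q" "\<forall>\<^sub>F \<epsilon> in at_right 0. \<forall>k<N \<epsilon>. e \<epsilon> k = e' \<epsilon> k" for e e' q
  proof -
    obtain C where "\<forall>\<^sub>F \<epsilon> in at_right 0. \<forall>k<N \<epsilon>. \<bar>e \<epsilon> k\<bar> \<le> C * \<epsilon> ^ (q + 1)"
      using \<open>local_order N e q\<close> unfolding local_order_def by blast
    then have "\<forall>\<^sub>F \<epsilon> in at_right 0. \<forall>k<N \<epsilon>. \<bar>e' \<epsilon> k\<bar> \<le> C * \<epsilon> ^ (q + 1)"
      using that(2) by eventually_elim simp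
    then show ?thesis unfolding local_order_def by blast
  qed
  \<comment> \<open>The unreduced multipliers serve as witnesses for the reduced ones.\<close>
  have "corresponding_reduced G ?l a t0 N g v ?\<xi> lam"
    unfolding corresponding_reduced_def using red by (rule eventually_mono) simp
  moreover have "eps_integrator G ?l a \<nu> t0 N \<xi> lamr (\<lambda>\<epsilon> k. left_triv G (gs \<epsilon> k) (vs \<epsilon> k)) ls l s"
    if "corresponding_reduced G ?l a t0 N g v \<xi> lamr" for \<xi> lamr
  proof -
    have corr: "\<forall>\<^sub>F \<epsilon> in at_right 0. \<forall>k<N \<epsilon>.
        eps_solution G ?l a (step_interval t0 \<epsilon> k) (\<xi> \<epsilon> k) (lamr \<epsilon> k) \<and>
        (\<forall>t\<in>step_interval t0 \<epsilon> k. \<xi> \<epsilon> k t = ?\<xi> \<epsilon> k t)"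
      using that unfolding corresponding_reduced_def .
    \<comment> \<open>On each step both pairs solve the reduced equations from the same initial
      point. A positive step size makes the interval nondegenerate, so \<open>eps_unique\<close>
      applies and identifies the multipliers too.\<close>
    have agree: "\<forall>\<^sub>F \<epsilon> in at_right 0. \<forall>k<N \<epsilon>.
        ?\<xi> \<epsilon> k (time_node t0 \<epsilon> k + \<epsilon>) = \<xi> \<epsilon> k (time_node t0 \<epsilon> k + \<epsilon>) \<and>
        lam \<epsilon> k (time_node t0 \<epsilon> k + \<epsilon>) = lamr \<epsilon> k (time_node t0 \<epsilon> k + \<epsilon>)"
      using corr red pos
    proof eventually_elim
      case (elim \<epsilon>)
      show ?case
      proof (intro allI impI)
        fix k assume k: "k < N \<epsilon>"
        let ?t = "time_node t0 \<epsilon> k"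
        have "eps_solution G ?l a {?t..?t + \<epsilon>} (?\<xi> \<epsilon> k) (lam \<epsilon> k)"
          "eps_solution G ?l a {?t..?t + \<epsilon>} (\<xi> \<epsilon> k) (lamr \<epsilon> k)"
          "?\<xi> \<epsilon> k ?t = \<xi> \<epsilon> k ?t" "?t < ?t + \<epsilon>"
          using elim k by (auto simp: step_interval_def)
        then have "\<forall>t\<in>{?t..?t + \<epsilon>}. ?\<xi> \<epsilon> k t = \<xi> \<epsilon> k t \<and> lam \<epsilon> k t = lamr \<epsilon> k t"
          using assms(3) unfolding eps_unique_def by blast
        then show "?\<xi> \<epsilon> k (?t + \<epsilon>) = \<xi> \<epsilon> k (?t + \<epsilon>) \<and> lam \<epsilon> k (?t + \<epsilon>) = lamr \<epsilon> k (?t + \<epsilon>)"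
          using \<open>?t < ?t + \<epsilon>\<close> by simp
      qed
    qed
    show ?thesis
      unfolding eps_integrator_def
    proof (intro conjI)
      show "\<forall>\<^sub>F \<epsilon> in at_right 0. \<forall>k\<le>N \<epsilon>. left_triv G (gs \<epsilon> k) (vs \<epsilon> k) \<in> lie_algebra G"
        using nodes by (rule eventually_mono) (blast intro: left_triv_in)
      show "\<forall>\<^sub>F \<epsilon> in at_right 0. \<forall>k<N \<epsilon>. eps_solution G ?l a (step_interval t0 \<epsilon> k) (\<xi> \<epsilon> k) (lamr \<epsilon> k)"
        using corr by (rule eventually_mono) blast
      \<comment> \<open>After this identification the reduced error is the left-trivialized velocity
        error itself, so the order is \<open>l\<close> and not \<open>min r l\<close>.\<close>
      show "local_order N (\<lambda>\<epsilon> k. \<nu> (tminus (\<xi> \<epsilon> k (time_node t0 \<epsilon> k + \<epsilon>))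
          (left_triv G (gs \<epsilon> (k + 1)) (vs \<epsilon> (k + 1))))) l"
        by (rule order_cong[OF vel]) (use agree in \<open>rule eventually_mono; simp\<close>)
      show "local_order N (\<lambda>\<epsilon> k. dist (lamr \<epsilon> k (time_node t0 \<epsilon> k + \<epsilon>)) (ls \<epsilon> (k + 1))) s"
        by (rule order_cong[OF mult]) (use agree in \<open>rule eventually_mono; simp\<close>)
    qed
  qed
  ultimately show ?thesis by blast
qed

end
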